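(* Let $q\in\mathbb{N}$ be fixed, and suppose that $\langle N\rangle\to\infty$, $\langle M\rangle\to\infty$ and $\kappa:=\langle M\rangle^{q+1}/\langle N\rangle\to0$. Then for any $x>0$ the random value $\widetilde Y_\lambda(x)$ is asymptotically normal with variance $\omega_q^*(x)/\langle M\rangle$, that is, under $\mathsf{P}_{\boldsymbol z}$, $$\widetilde Y^*_\lambda(x):=\sqrt{\langle M\rangle}\left(\widetilde Y_\lambda(x)-\mathsf{E}_{\boldsymbol z}\bigl(\widetilde Y_\lambda(x)\bigr)\right)\to\mathcal{N}\bigl(0,\omega_q^*(x)\bigr)\quad\text{in distribution}.$$
   Context: $\mathbb{N}=\{1,2,\dots\}$, $\mathbb{N}^q=\{j^q: j\in\mathbb{N}\}$. $\check{\Lambda}^q$ is the set of all strict integer partitions into $q$-th powers, i.e. finite (possibly empty) sequences $\lambda_1>\lambda_2>\cdots$ of distinct elements of $\mathbb{N}^q$. For $\lambda\in\check\Lambda^q$ and $\ell\in\mathbb{N}^q$, $\nu_\ell\in\{0,1\}$ is the multiplicity of $\ell$ in $\lambda$; the weight is $N_\lambda=\sum_\ell\ell\nu_\ell$, the length is $M_\lambda=\sum_\ell\nu_\ell$. For $\boldsymbol z=(z_1,z_2)$ with $0<z_1<1$, $z_2>0$, the Boltzmann distribution on $\check\Lambda^q$ is $\mathsf{P}_{\boldsymbol z}(\lambda)=z_1^{N_\lambda}z_2^{M_\lambda}/F(\boldsymbol z)$, where $F(\boldsymbol z)=\sum_{\lambda\in\check\Lambda^q}z_1^{N_\lambda}z_2^{M_\lambda}$;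 $\mathsf{E}_{\boldsymbol z}$ is the corresponding expectation. Given real hyper-parameters $\langle N\rangle,\langle M\rangle>0$, $\boldsymbol z$ is calibrated as the root of $\mathsf{E}_{\boldsymbol z}(N_\lambda)=\langle N\rangle$, $\mathsf{E}_{\boldsymbol z}(M_\lambda)=\langle M\rangle$; it satisfies $z_1=\exp\bigl(-\frac{\langle M\rangle}{q\langle N\rangle}(1+O(\kappa^{1/q}))\bigr)$, $z_2=\frac{\kappa^{1/q}}{q^{1/q}\Gamma(1+1/q)}(1+O(\kappa^{1/q}))$. The upper boundary of the Young diagram of $\lambda$ is $Y_\lambda(x)=\sum_{\ell\ge x}\nu_\ell$ ($x\ge0$). With $A:=q\langle N\rangle/\langle M\rangle$ and $B:=\langle M\rangle$, the scaled boundary is $\widetilde Y_\lambda(x)=B^{-1}Y_\lambda(Ax)$. The limit shape is $\omega_q^*(x)=\frac{1}{\Gamma(1/q)}\int_x^\infty u^{1/q-1}e^{-u}\,du$, $x\ge0$. *)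

theory Defs
  imports "HOL-Probability.Probability"
begin

definition qth_powers :: "nat \<Rightarrow> nat set" where
  "qth_powers q = {j ^ q |j. 1 \<le> j}"

definition strict_partitions :: "nat \<Rightarrow> nat list set" where
  "strict_partitions q = {p. sorted_wrt (>) p \<and> set p \<subseteq> qth_powers q}"

text \<open>Multiplicities are given by \<^const>\<open>count_list\<close>. The sums over all parts \<open>l\<close> are restricted
  to the finitely many \<open>l\<close> of nonzero multiplicity.\<close>

definition part_weight :: "nat list \<Rightarrow> nat" where
  "part_weight p = (\<Sum>l\<in>set p. l * count_list p l)"

definition part_length :: "nat list \<Rightarrow> nat" where
  "part_length p = (\<Sum>l\<in>set p. count_list p l)"

definition young_boundary :: "nat list \<Rightarrow> real \<Rightarrow> nat" where
  "young_boundary p x = (\<Sum>l\<in>{l \<in> set p. x \<le> real l}. count_list p l)"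

definition gen_fun :: "nat \<Rightarrow> real \<Rightarrow> real \<Rightarrow> real" where
  "gen_fun q z1 z2 = (\<Sum>\<^sub>\<infinity>p\<in>strict_partitions q. z1 ^ part_weight p * z2 ^ part_length p)"

text \<open>\<^const>\<open>embed_pmf\<close> is only meaningful for a function that is a probability mass function; for
  \<open>0 < z1 < 1\<close> and \<open>0 < z2\<close> this is lemma \<open>pmf_boltzmann\<close> below.\<close>

definition boltzmann :: "nat \<Rightarrow> real \<Rightarrow> real \<Rightarrow> nat list pmf" where
  "boltzmann q z1 z2 = embed_pmf (\<lambda>p. if p \<in> strict_partitions q
     then z1 ^ part_weight p * z2 ^ part_length p / gen_fun q z1 z2 else 0)"

definition calibrated :: "nat \<Rightarrow> real \<Rightarrow> real \<Rightarrow> real \<Rightarrow> real \<Rightarrow> bool" where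
  "calibrated q N M z1 z2 \<longleftrightarrow> 0 < z1 \<and> z1 < 1 \<and> 0 < z2 \<and>
     measure_pmf.expectation (boltzmann q z1 z2) (\<lambda>p. real (part_weight p)) = N \<and>
     measure_pmf.expectation (boltzmann q z1 z2) (\<lambda>p. real (part_length p)) = M"

definition scaled_boundary :: "nat \<Rightarrow> real \<Rightarrow> real \<Rightarrow> nat list \<Rightarrow> real \<Rightarrow> real" where
  "scaled_boundary q N M p x = (let A = real q * N / M; B = M in real (young_boundary p (A * x)) / B)"

definition limit_shape :: "nat \<Rightarrow> real \<Rightarrow> real" where
  "limit_shape q x = 1 / Gamma (1 / real q) * integral {x..} (\<lambda>u. u powr (1 / real q - 1) * exp (- u))"

lemma distinct_strict_partition: "p \<in> strict_partitions q \<Longrightarrow> distinct p"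
proof -
  assume "p \<in> strict_partitions q"
  hence "sorted_wrt (<) (rev p)" by (simp add: strict_partitions_def sorted_wrt_rev)
  hence "distinct (rev p)" using strict_sorted_iff by blast
  thus ?thesis by simp
qed

lemma inj_on_set_strict_partitions: "inj_on set (strict_partitions q)"
proof (rule inj_onI)
  fix a b assume *: "a \<in> strict_partitions q" "b \<in> strict_partitions q" "set a = set b"
  hence "sorted_wrt (<) (rev a)" "sorted_wrt (<) (rev b)" "set (rev a) = set (rev b)"
    by (simp_all add: strict_partitions_def sorted_wrt_rev)
  hence "rev a = rev b" using strict_sorted_equal by blast
  thus "a = b" by simp
qed

lemma boltzmann_weight_eq_prod:
  fixes z1 z2 :: real
  assumes "p \<in> strict_partitions q"
  shows "z1 ^ part_weight p * z2 ^ part_length p = (\<Prod>l\<in>set p. z1 ^ l * z2)"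
proof -
  have "distinct xs \<Longrightarrow> l \<in> set xs \<Longrightarrow> count_list xs l = 1" for xs :: "nat list" and l
    by (induction xs) (auto simp: count_list_0_iff)
  hence "count_list p l = 1" if "l \<in> set p" for l
    using distinct_strict_partition[OF assms] that by blast
  hence "part_weight p = \<Sum> (set p)" "part_length p = card (set p)"
    by (simp_all add: part_weight_def part_length_def)
  thus ?thesis by (simp add: prod.distrib power_sum)
qed

lemma summable_boltzmann_weight:
  fixes z1 z2 :: real
  assumes z: "0 < z1" "z1 < 1" "0 < z2"
  shows "(\<lambda>p. z1 ^ part_weight p * z2 ^ part_length p) summable_on strict_partitions q"
proof (rule nonneg_bdd_above_summable_on)
  show "bdd_above (sum (\<lambda>p. z1 ^ part_weight p * z2 ^ part_length p) `
          {S. S \<subseteq> strict_partitions q \<and> finite S})"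
  proof (rule bdd_aboveI2)
    fix S assume "S \<in> {S. S \<subseteq> strict_partitions q \<and> finite S}"
    hence S: "S \<subseteq> strict_partitions q" "finite S" by auto
    define T where "T = (\<Union>p\<in>S. set p)"
    have T: "finite T" using S by (simp add: T_def)
    have "(\<Sum>p\<in>S. z1 ^ part_weight p * z2 ^ part_length p) = (\<Sum>p\<in>S. \<Prod>l\<in>set p. z1 ^ l * z2)"
      by (rule sum.cong) (use S in \<open>auto simp: boltzmann_weight_eq_prod\<close>)
    also have "\<dots> = (\<Sum>R\<in>set ` S. \<Prod>l\<in>R. z1 ^ l * z2)"
      by (subst sum.reindex) (use inj_on_subset[OF inj_on_set_strict_partitions S(1)] in auto)
    also have "\<dots> \<le> (\<Sum>R\<in>Pow T. \<Prod>l\<in>R. z1 ^ l * z2)"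
      by (rule sum_mono2) (use T z in \<open>auto simp: T_def intro!: prod_nonneg\<close>)
    also have "\<dots> = (\<Prod>l\<in>T. z1 ^ l * z2 + 1)"
      using prod_add[OF T, of "\<lambda>l. z1 ^ l * z2" "\<lambda>_. 1"] by simp
    also have "\<dots> \<le> (\<Prod>l\<in>T. exp (z1 ^ l * z2))"
      by (rule prod_mono) (use z in \<open>auto simp: add.commute intro!: add_nonneg_nonneg\<close>)
    also have "\<dots> = exp ((\<Sum>l\<in>T. z1 ^ l) * z2)"
      using T by (simp add: exp_sum sum_distrib_right)
    also have "\<dots> \<le> exp ((\<Sum>l. z1 ^ l) * z2)"
      using z T sum_le_suminf[of "\<lambda>l. z1 ^ l" T] summable_geometric[of z1] by simp
    finally show "(\<Sum>p\<in>S. z1 ^ part_weight p * z2 ^ part_length p) \<le> exp ((\<Sum>l. z1 ^ l) * z2)" .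
  qed
qed (use z in auto)

lemma gen_fun_pos:
  fixes z1 z2 :: real
  assumes z: "0 < z1" "z1 < 1" "0 < z2"
  shows "0 < gen_fun q z1 z2"
proof -
  have "(\<Sum>p\<in>{[]}. z1 ^ part_weight p * z2 ^ part_length p) \<le> gen_fun q z1 z2"
    unfolding gen_fun_def
    by (rule finite_sum_le_infsum[OF summable_boltzmann_weight])
       (use z in \<open>auto simp: strict_partitions_def\<close>)
  thus ?thesis by (simp add: part_weight_def part_length_def)
qed

lemma pmf_boltzmann:
  fixes z1 z2 :: real
  assumes z: "0 < z1" "z1 < 1" "0 < z2"
  shows "pmf (boltzmann q z1 z2) p = (if p \<in> strict_partitions q
     then z1 ^ part_weight p * z2 ^ part_length p / gen_fun q z1 z2 else 0)"
  unfolding boltzmann_def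
proof (rule pmf_embed_pmf)
  let ?w = "\<lambda>p. z1 ^ part_weight p * z2 ^ part_length p"
  let ?f = "\<lambda>p. if p \<in> strict_partitions q then ?w p / gen_fun q z1 z2 else 0"
  note pos = gen_fun_pos[OF z, of q]
  show nn: "\<And>p. 0 \<le> ?f p" using pos z by auto
  have "(?w has_sum gen_fun q z1 z2) (strict_partitions q)"
    unfolding gen_fun_def by (rule has_sum_infsum[OF summable_boltzmann_weight[OF z]])
  from has_sum_cmult_left[OF this, of "1 / gen_fun q z1 z2"] pos
  have "((\<lambda>p. ?w p / gen_fun q z1 z2) has_sum 1) (strict_partitions q)" by simp
  hence "(?f has_sum 1) UNIV"
    by (subst has_sum_cong_neutral[where T = "strict_partitions q"
          and g = "\<lambda>p. ?w p / gen_fun q z1 z2"]) auto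
  hence f1: "infsum ?f UNIV = 1" and "?f summable_on UNIV"
    by (fact infsumI, fact has_sum_imp_summable)
  from this(2) have "Infinite_Sum.abs_summable_on ?f UNIV" by (rule summable_on_iff_abs_summable_on_real[THEN iffD1])
  hence sm: "Infinite_Set_Sum.abs_summable_on ?f UNIV" by (rule abs_summable_equivalent[THEN iffD1])
  have "integrable (count_space UNIV) ?f"
    using sm unfolding Infinite_Set_Sum.abs_summable_on_def .
  moreover have "(LINT p|count_space UNIV. ?f p) = 1"
    using infsetsum_infsum[OF sm] f1 unfolding infsetsum_def by (rule trans)
  ultimately
  show "(\<integral>\<^sup>+p. ennreal (?f p) \<partial>count_space UNIV) = 1"
    using nn nn_integral_eq_integral[of "count_space UNIV" ?f] by simp
qed

end

theory Submission
  imports Defs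
begin

text \<open>Under the Boltzmann distribution the multiplicities of the parts \<open>l\<close> are independent Bernoulli
  variables with success probability \<open>p l = z1 ^ l * z2 / (1 + z1 ^ l * z2) \<le> z2\<close>. Hence \<open>Y\<close>, of mean
  \<open>m\<close>, is close to a Poisson variable: its characteristic function at \<open>s = t / sqrt M\<close> differs from
  \<open>exp (m * (iexp s - 1))\<close> by \<open>O(s\<^sup>2 * z2 * m)\<close>, and the centred Poisson law tends to a Gaussian one by
  a Taylor expansion, provided that \<open>z2 \<longlonglongrightarrow> 0\<close> and \<open>m / M \<longlonglongrightarrow> limit_shape q x\<close>. The former is forced by
  \<open>\<kappa> \<longlonglongrightarrow> 0\<close>. Then \<open>\<alpha> = - ln z1 \<longlonglongrightarrow> 0\<close> too, and \<open>M\<close>, \<open>N\<close> and \<open>m\<close> are, up to powers of \<open>\<alpha>\<close> and the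
  factor \<open>z2\<close>, Riemann sums of mesh \<open>\<alpha> powr (1 / q)\<close> for \<open>exp (- (y ^ q))\<close>, \<open>y ^ q * exp (- (y ^ q))\<close> and
  the restriction of \<open>exp (- (y ^ q))\<close> to \<open>y ^ q \<ge> x\<close>.\<close>

subsection \<open>Independence of the multiplicities and Poisson approximation\<close>

definition part_prob :: "real \<Rightarrow> real \<Rightarrow> nat \<Rightarrow> real" where
  "part_prob z1 z2 l = z1 ^ l * z2 / (1 + z1 ^ l * z2)"

text \<open>Finite exhaustion of \<open>strict_partitions q\<close> on which sums over partitions
  factorise. Indexing by \<open>Suc j\<close> makes \<open>j < n\<close> run through the parts
  \<open>1 ^ q, ..., n ^ q\<close>.\<close>

definition truncated_partitions :: "nat \<Rightarrow> nat \<Rightarrow> nat list set" where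
  "truncated_partitions q n = {p \<in> strict_partitions q. set p \<subseteq> (\<lambda>j. Suc j ^ q) ` {..<n}}"

lemma qth_powers_eq: "qth_powers q = range (\<lambda>j. Suc j ^ q)"
proof (intro equalityI subsetI)
  fix l assume "l \<in> qth_powers q"
  then obtain j where "l = j ^ q" "1 \<le> j" by (auto simp: qth_powers_def)
  hence "l = Suc (j - 1) ^ q" by simp
  thus "l \<in> range (\<lambda>j. Suc j ^ q)" by blast
next
  fix l assume "l \<in> range (\<lambda>j. Suc j ^ q)"
  then obtain j where "l = Suc j ^ q" by blast
  thus "l \<in> qth_powers q" unfolding qth_powers_def by (intro CollectI exI[of _ "Suc j"]) simp
qed

lemma inj_Suc_power: "1 \<le> q \<Longrightarrow> inj_on (\<lambda>j. Suc j ^ q) A"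
proof (rule inj_onI)
  fix i j assume "1 \<le> q" "Suc i ^ q = Suc j ^ q"
  thus "i = j" using power_eq_iff_eq_base[of q "Suc i" "Suc j"] by linarith
qed

text \<open>A strict partition is determined by its set of parts, and any finite set of admissible
  parts is realised by listing it in decreasing order.\<close>

lemma bij_betw_set_truncated_partitions:
  "bij_betw set (truncated_partitions q n) (Pow ((\<lambda>j. Suc j ^ q) ` {..<n}))"
  unfolding bij_betw_def
proof
  show "inj_on set (truncated_partitions q n)"
    by (rule inj_on_subset[OF inj_on_set_strict_partitions]) (auto simp: truncated_partitions_def)
  show "set ` truncated_partitions q n = Pow ((\<lambda>j. Suc j ^ q) ` {..<n})"
  proof (intro equalityI subsetI)
    fix R assume R: "R \<in> Pow ((\<lambda>j. Suc j ^ q) ` {..<n})"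
    hence "finite R" using finite_subset by blast
    have "rev (sorted_list_of_set R) \<in> truncated_partitions q n"
      using R \<open>finite R\<close>
      by (auto simp: truncated_partitions_def strict_partitions_def sorted_wrt_rev qth_powers_eq
          strict_sorted_list_of_set)
    moreover have "set (rev (sorted_list_of_set R)) = R" using \<open>finite R\<close> by simp
    ultimately show "R \<in> set ` truncated_partitions q n" by (metis image_eqI)
  qed (auto simp: truncated_partitions_def)
qed

lemma finite_truncated_partitions: "finite (truncated_partitions q n)"
  using bij_betw_finite[OF bij_betw_set_truncated_partitions[of q n]] by simp

text \<open>Expanding the product chooses, factor by factor, whether a part occurs; the choices are
  exactly the truncated partitions.\<close>

lemma sum_truncated_partitions:
  fixes f :: "nat \<Rightarrow> 'a::comm_semiring_1"
  assumes "1 \<le> q"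
  shows "(\<Sum>p\<in>truncated_partitions q n. \<Prod>l\<in>set p. f l) = (\<Prod>j<n. f (Suc j ^ q) + 1)"
proof -
  have "(\<Sum>p\<in>truncated_partitions q n. \<Prod>l\<in>set p. f l)
      = (\<Sum>R\<in>Pow ((\<lambda>j. Suc j ^ q) ` {..<n}). \<Prod>l\<in>R. f l)"
    by (rule sum.reindex_bij_betw[OF bij_betw_set_truncated_partitions])
  also have "\<dots> = (\<Prod>l\<in>(\<lambda>j. Suc j ^ q) ` {..<n}. f l + 1)"
    by (subst prod_add) auto
  also have "\<dots> = (\<Prod>j<n. f (Suc j ^ q) + 1)"
    by (subst prod.reindex) (use inj_Suc_power[OF assms] in auto)
  finally show ?thesis .
qed

lemma eventually_truncated_partitions:
  assumes "p \<in> strict_partitions q"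
  shows "\<forall>\<^sub>F n in sequentially. p \<in> truncated_partitions q n"
proof -
  have "set p \<subseteq> range (\<lambda>j. Suc j ^ q)" using assms by (auto simp: strict_partitions_def qth_powers_eq)
  then obtain J where J: "set p = (\<lambda>j. Suc j ^ q) ` J" "finite J"
    by (metis List.finite_set finite_subset_image)
  then obtain m where "J \<subseteq> {..<m}" using finite_nat_iff_bounded by blast
  hence "p \<in> truncated_partitions q n" if "n \<ge> m" for n
    using that assms J by (force simp: truncated_partitions_def)
  thus ?thesis by (auto simp: eventually_sequentially)
qed

lemma set_pmf_boltzmann:
  assumes "0 < z1" "z1 < 1" "0 < z2"
  shows "set_pmf (boltzmann q z1 z2) \<subseteq> strict_partitions q"
  by (auto simp: set_pmf_iff pmf_boltzmann[OF assms] split: if_splits)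

text \<open>Independence of the multiplicities in transform form: each factor is the generating
  function of a Bernoulli variable with success probability \<open>part_prob z1 z2 l\<close>. The
  scalar type is left general because real \<open>u\<close> yields the marginals and complex
  \<open>u\<close> the characteristic function.\<close>

lemma boltzmann_prod_limit:
  fixes u :: "nat \<Rightarrow> 'a::{real_normed_field, banach, second_countable_topology}"
  assumes q: "1 \<le> q" and z: "0 < z1" "z1 < 1" "0 < z2" and u: "\<And>l. norm (u l) \<le> 1"
  shows "(\<lambda>n. \<Prod>j<n. 1 + of_real (part_prob z1 z2 (Suc j ^ q)) * (u (Suc j ^ q) - 1))
     \<longlonglongrightarrow> measure_pmf.expectation (boltzmann q z1 z2) (\<lambda>p. \<Prod>l\<in>set p. u l)"
proof -
  let ?w = "\<lambda>l. z1 ^ l * z2"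
  let ?E = "measure_pmf.expectation (boltzmann q z1 z2)"
  \<comment> \<open>The expectation restricted to truncated partitions is a finite sum, hence a
    product, still normalised by the full \<open>gen_fun\<close>. The separate type
    \<open>'b\<close> allows this to be applied both to \<open>u\<close> and to the real constant
    1.\<close>
  have trunc: "(\<lambda>n. (\<Prod>j<n. of_real (?w (Suc j ^ q)) * v (Suc j ^ q) + 1) /\<^sub>R gen_fun q z1 z2)
      \<longlonglongrightarrow> ?E (\<lambda>p. \<Prod>l\<in>set p. v l)"
    if v: "\<And>l. norm (v l) \<le> 1" for v :: "nat \<Rightarrow> 'b::{real_normed_field, banach, second_countable_topology}"
  proof -
    let ?g = "\<lambda>n p. if p \<in> truncated_partitions q n then \<Prod>l\<in>set p. v l else 0"
    have "?E (?g n) = (\<Prod>j<n. of_real (?w (Suc j ^ q)) * v (Suc j ^ q) + 1) /\<^sub>R gen_fun q z1 z2" for n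
    proof -
      have "?E (?g n) = (\<Sum>p\<in>truncated_partitions q n. pmf (boltzmann q z1 z2) p *\<^sub>R ?g n p)"
        by (rule integral_measure_pmf) (auto simp: finite_truncated_partitions split: if_splits)
      also have "\<dots> = (\<Sum>p\<in>truncated_partitions q n.
          (\<Prod>l\<in>set p. of_real (?w l) * v l) /\<^sub>R gen_fun q z1 z2)"
      proof (rule sum.cong[OF refl])
        fix p assume p: "p \<in> truncated_partitions q n"
        hence "p \<in> strict_partitions q" by (simp add: truncated_partitions_def)
        thus "pmf (boltzmann q z1 z2) p *\<^sub>R ?g n p = (\<Prod>l\<in>set p. of_real (?w l) * v l) /\<^sub>R gen_fun q z1 z2"
          using p by (simp add: pmf_boltzmann[OF z] boltzmann_weight_eq_prod prod.distrib
              scaleR_conv_of_real divide_inverse mult_ac del: of_real_mult of_real_power)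
            (simp add: prod.distrib)
      qed
      also have "\<dots> = (\<Prod>j<n. of_real (?w (Suc j ^ q)) * v (Suc j ^ q) + 1) /\<^sub>R gen_fun q z1 z2"
        using sum_truncated_partitions[OF q, of "\<lambda>l. of_real (?w l) * v l" n]
        by (simp add: scaleR_sum_right[symmetric])
      finally show ?thesis .
    qed
    \<comment> \<open>Every partition in the support eventually lies in the truncated sets, and
      \<open>norm (v l) \<le> 1\<close> provides the dominating constant 1.\<close>
    moreover have "(\<lambda>n. ?E (?g n)) \<longlonglongrightarrow> ?E (\<lambda>p. \<Prod>l\<in>set p. v l)"
    proof (rule integral_dominated_convergence[where w = "\<lambda>_. 1"])
      show "AE p in boltzmann q z1 z2. (\<lambda>n. ?g n p) \<longlonglongrightarrow> (\<Prod>l\<in>set p. v l)"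
        unfolding AE_measure_pmf_iff
      proof
        fix p assume "p \<in> set_pmf (boltzmann q z1 z2)"
        hence "p \<in> strict_partitions q" using set_pmf_boltzmann[OF z] by blast
        from eventually_truncated_partitions[OF this]
        show "(\<lambda>n. ?g n p) \<longlonglongrightarrow> (\<Prod>l\<in>set p. v l)"
          by (rule tendsto_eventually[OF eventually_mono]) simp
      qed
      show "AE p in boltzmann q z1 z2. norm (?g n p) \<le> 1" for n
        using v by (auto simp: prod_norm[symmetric] intro!: prod_le_1)
    qed auto
    ultimately show ?thesis by simp
  qed
  define P where "P n = (\<Prod>j<n. ?w (Suc j ^ q) + 1)" for n
  have P_pos: "P n > 0" for n unfolding P_def
    by (intro prod_pos) (use z in \<open>auto intro!: add_pos_pos\<close>)
  \<comment> \<open>The case \<open>v = 1\<close> is the Euler product for \<open>gen_fun\<close>.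
    Dividing by it replaces the global normalisation by one normalisation per factor.\<close>
  have "(\<lambda>n. P n / gen_fun q z1 z2) \<longlonglongrightarrow> 1"
    using trunc[of "\<lambda>_. 1::real"] by (simp add: P_def divide_inverse mult.commute)
  from tendsto_divide[OF trunc[OF u] tendsto_of_real[OF this]]
  have "(\<lambda>n. ((\<Prod>j<n. of_real (?w (Suc j ^ q)) * u (Suc j ^ q) + 1) /\<^sub>R gen_fun q z1 z2)
      / of_real (P n / gen_fun q z1 z2)) \<longlonglongrightarrow> ?E (\<lambda>p. \<Prod>l\<in>set p. u l)" by simp
  moreover have "((\<Prod>j<n. of_real (?w (Suc j ^ q)) * u (Suc j ^ q) + 1) /\<^sub>R gen_fun q z1 z2)
      / of_real (P n / gen_fun q z1 z2)
      = (\<Prod>j<n. 1 + of_real (part_prob z1 z2 (Suc j ^ q)) * (u (Suc j ^ q) - 1))" for n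
  proof -
    \<comment> \<open>With \<open>w = z1 ^ l * z2\<close>, the quotient
      \<open>(1 + w * u) / (1 + w)\<close> is the Bernoulli transform for success probability
      \<open>w / (1 + w)\<close>.\<close>
    have "1 + of_real (part_prob z1 z2 l) * (u l - 1)
        = (of_real (?w l) * u l + 1) / of_real (?w l + 1)" for l
    proof -
      have "?w l + 1 \<noteq> 0" using z by (metis add_pos_pos less_numeral_extra(3) mult_pos_pos zero_less_one zero_less_power)
      hence "(of_real (?w l + 1) :: 'a) \<noteq> 0" by (simp only: of_real_eq_0_iff not_False_eq_True)
      moreover have "of_real (part_prob z1 z2 l) = (of_real (?w l) / of_real (?w l + 1) :: 'a)"
        by (simp add: part_prob_def add.commute)
      ultimately show ?thesis by (simp add: field_simps)
    qed
    hence "(\<Prod>j<n. 1 + of_real (part_prob z1 z2 (Suc j ^ q)) * (u (Suc j ^ q) - 1))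
       = (\<Prod>j<n. of_real (?w (Suc j ^ q)) * u (Suc j ^ q) + 1) / of_real (P n)"
      by (simp only: prod_dividef P_def of_real_prod)
    thus ?thesis using gen_fun_pos[OF z, of q] P_pos[of n]
      by (simp add: scaleR_conv_of_real field_simps)
  qed
  ultimately show ?thesis by simp
qed

section \<open>Marginal probabilities and expectations of additive functionals\<close>

lemma prob_part:
  assumes q: "1 \<le> q" and z: "0 < z1" "z1 < 1" "0 < z2"
  shows "measure_pmf.prob (boltzmann q z1 z2) {p. Suc i ^ q \<in> set p} = part_prob z1 z2 (Suc i ^ q)"
proof -
  \<comment> \<open>With this choice the product over the parts of \<open>p\<close> is the indicator
    that the part \<open>Suc i ^ q\<close> is absent, and only the factor with index
    \<open>i\<close> differs from 1.\<close>
  let ?u = "\<lambda>l. if l = Suc i ^ q then 0 else 1 :: real"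
  let ?B = "boltzmann q z1 z2"
  have "(\<lambda>n. \<Prod>j<n. 1 + part_prob z1 z2 (Suc j ^ q) * (?u (Suc j ^ q) - 1))
     \<longlonglongrightarrow> measure_pmf.expectation ?B (\<lambda>p. \<Prod>l\<in>set p. ?u l)"
    using boltzmann_prod_limit[OF q z, of ?u] by simp
  moreover have "\<forall>\<^sub>F n in sequentially. (\<Prod>j<n. 1 + part_prob z1 z2 (Suc j ^ q) * (?u (Suc j ^ q) - 1))
     = 1 - part_prob z1 z2 (Suc i ^ q)"
  proof (rule eventually_sequentiallyI[of "Suc i"])
    fix n assume "Suc i \<le> n"
    have "(\<Prod>j<n. 1 + part_prob z1 z2 (Suc j ^ q) * (?u (Suc j ^ q) - 1))
        = (\<Prod>j<n. if j = i then 1 - part_prob z1 z2 (Suc i ^ q) else 1)"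
      using inj_on_eq_iff[OF inj_Suc_power[OF q, of UNIV]] by (intro prod.cong) simp_all
    also have "\<dots> = 1 - part_prob z1 z2 (Suc i ^ q)"
      using \<open>Suc i \<le> n\<close> by (simp add: prod.delta)
    finally show "(\<Prod>j<n. 1 + part_prob z1 z2 (Suc j ^ q) * (?u (Suc j ^ q) - 1)) = \<dots>" .
  qed
  ultimately have "measure_pmf.expectation ?B (\<lambda>p. \<Prod>l\<in>set p. ?u l) = 1 - part_prob z1 z2 (Suc i ^ q)"
    by (rule LIMSEQ_unique[OF _ tendsto_eventually])
  moreover have "(\<Prod>l\<in>set p. ?u l) = indicator (- {p. Suc i ^ q \<in> set p}) p" for p
    by (auto simp: indicator_def prod_zero_iff)
  ultimately have "measure_pmf.prob ?B (- {p. Suc i ^ q \<in> set p}) = 1 - part_prob z1 z2 (Suc i ^ q)"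
    by simp
  thus ?thesis
    using measure_pmf.prob_compl[of "{p. Suc i ^ q \<in> set p}" ?B] by (simp add: Compl_eq_Diff_UNIV)
qed

lemma part_prob_nonneg: "0 < z1 \<Longrightarrow> 0 < z2 \<Longrightarrow> 0 \<le> part_prob z1 z2 l"
  by (simp add: part_prob_def)

lemma part_prob_le: "0 < z1 \<Longrightarrow> 0 < z2 \<Longrightarrow> part_prob z1 z2 l \<le> z1 ^ l * z2"
  unfolding part_prob_def by (simp add: divide_le_eq add_pos_pos mult_le_cancel_left1)

lemma part_prob_le_1: "0 < z1 \<Longrightarrow> 0 < z2 \<Longrightarrow> part_prob z1 z2 l \<le> 1"
  unfolding part_prob_def by (simp add: divide_le_eq add_pos_pos)

text \<open>The functional is a series of weighted indicators over all q-th powers, with finitely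
  many nonzero terms for each partition. Nonnegativity of \<open>g\<close> turns \<open>sm\<close>
  into the absolute summability that permits exchanging series and expectation.\<close>

lemma expectation_additive:
  assumes q: "1 \<le> q" and z: "0 < z1" "z1 < 1" "0 < z2"
    and g: "\<And>l. 0 \<le> g l" and sm: "summable (\<lambda>j. g (Suc j ^ q) * part_prob z1 z2 (Suc j ^ q))"
  shows "measure_pmf.expectation (boltzmann q z1 z2) (\<lambda>p. \<Sum>l\<in>set p. g l)
     = (\<Sum>j. g (Suc j ^ q) * part_prob z1 z2 (Suc j ^ q))"
proof -
  let ?B = "boltzmann q z1 z2"
  let ?f = "\<lambda>j p. g (Suc j ^ q) * indicator {p. Suc j ^ q \<in> set p} p :: real"
  have sums: "(\<lambda>j. ?f j p) sums (\<Sum>l\<in>set p. g l)" if "p \<in> strict_partitions q" for p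
  proof -
    have "set p \<subseteq> range (\<lambda>j. Suc j ^ q)" using that by (auto simp: strict_partitions_def qth_powers_eq)
    then obtain J where J: "set p = (\<lambda>j. Suc j ^ q) ` J" "finite J"
      by (metis List.finite_set finite_subset_image)
    have "(\<Sum>l\<in>set p. g l) = (\<Sum>j\<in>J. g (Suc j ^ q))"
      unfolding J(1) by (rule sum.reindex[OF inj_Suc_power[OF q], unfolded o_def])
    also have "\<dots> = (\<Sum>j\<in>J. ?f j p)" using J by (intro sum.cong) auto
    finally have "(\<Sum>l\<in>set p. g l) = (\<Sum>j\<in>J. ?f j p)" .
    moreover have "?f j p = 0" if "j \<notin> J" for j
      using inj_image_mem_iff[OF inj_Suc_power[OF q], of j J] that J(1) by simp
    ultimately show ?thesis using sums_finite[OF J(2), of "\<lambda>j. ?f j p"] by simp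
  qed
  have prob: "measure_pmf.expectation ?B (?f j) = g (Suc j ^ q) * part_prob z1 z2 (Suc j ^ q)" for j
    by (simp add: prob_part[OF q z, symmetric])
  have "(\<Sum>j. measure_pmf.expectation ?B (?f j)) = measure_pmf.expectation ?B (\<lambda>p. \<Sum>j. ?f j p)"
  proof (rule integral_suminf[symmetric])
    show "integrable ?B (?f j)" for j
      by (rule measure_pmf.integrable_const_bound[where B = "g (Suc j ^ q)"]) (auto simp: g indicator_def)
    show "AE p in ?B. summable (\<lambda>j. norm (?f j p))"
      unfolding AE_measure_pmf_iff
    proof
      fix p assume "p \<in> set_pmf ?B"
      hence "p \<in> strict_partitions q" using set_pmf_boltzmann[OF z] by blast
      from sums_summable[OF sums[OF this]] show "summable (\<lambda>j. norm (?f j p))"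
        by (simp add: abs_mult g)
    qed
    show "summable (\<lambda>j. LINT p|?B. norm (?f j p))"
      using sm by (simp add: g prob_part[OF q z])
  qed
  also have "\<dots> = measure_pmf.expectation ?B (\<lambda>p. \<Sum>l\<in>set p. g l)"
    using sums set_pmf_boltzmann[OF z, of q]
    by (intro integral_cong_AE) (auto simp: AE_measure_pmf_iff sums_iff)
  finally show ?thesis by (simp only: prob)
qed

section \<open>Bernoulli products against Poisson characteristic functions\<close>

lemma norm_one_plus_bernoulli_le:
  assumes "0 \<le> p" "p \<le> 1" "norm (u :: complex) \<le> 1"
  shows "norm (1 + of_real p * (u - 1)) \<le> 1"
proof -
  \<comment> \<open>Written as a convex combination of 1 and \<open>u\<close>, the value visibly
    stays in the unit disc.\<close>
  have "1 + of_real p * (u - 1) = of_real (1 - p) + of_real p * u" by (simp add: algebra_simps)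
  also have "norm \<dots> \<le> (1 - p) + p * norm u"
    using assms by (metis abs_of_nonneg diff_ge_0_iff_ge norm_mult norm_of_real norm_triangle_ineq)
  also have "\<dots> \<le> 1" using assms by (simp add: mult_left_le)
  finally show ?thesis .
qed

text \<open>Taylor remainder of the exponential at \<open>v = p * (iexp s - 1)\<close>. The crude
  bound \<open>norm v \<le> 2\<close> controls the factor \<open>exp (norm v)\<close>, while
  \<open>norm v \<le> p * \<bar>s\<bar>\<close> controls the square.\<close>

lemma norm_exp_bernoulli_diff_le:
  assumes "0 \<le> p" "p \<le> 1"
  shows "norm (1 + of_real p * (iexp s - 1) - exp (of_real p * (iexp s - 1))) \<le> exp 2 * s\<^sup>2 * p\<^sup>2"
proof -
  let ?v = "of_real p * (iexp s - 1)"
  have s: "norm (iexp s - 1) \<le> \<bar>s\<bar>" using iexp_approx1[of s 0] by simp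
  have "norm (iexp s - 1) \<le> norm (iexp s) + norm (1::complex)" by (rule norm_triangle_ineq4)
  hence "norm (iexp s - 1) \<le> 2" by simp
  hence v: "norm ?v \<le> 2" using assms mult_mono[of p 1 "norm (iexp s - 1)" 2] by (simp add: norm_mult)
  have "norm (exp ?v - (1 + ?v)) \<le> exp (norm ?v) * (norm ?v)\<^sup>2"
    using Taylor_exp_field[of ?v 1] by (simp add: power2_eq_square)
  also have "\<dots> \<le> exp 2 * (p * \<bar>s\<bar>)\<^sup>2"
    using v s assms by (intro mult_mono power_mono) (auto simp: norm_mult intro!: mult_left_mono)
  finally show ?thesis by (simp add: norm_minus_commute power_mult_distrib mult_ac)
qed

text \<open>\<open>exp (m * (iexp s - 1))\<close> is the Poisson characteristic function. It factors
  in parallel with the Bernoulli product; as all factors lie in the unit disc, the distance of the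
  products is at most the sum of the distances of the factors. These are of order
  \<open>s\<^sup>2 * p\<^sup>2\<close>, and one factor \<open>p\<close> is bounded by
  \<open>z2\<close>.\<close>

lemma char_poisson_approx:
  assumes q: "1 \<le> q" and z: "0 < z1" "z1 < 1" "0 < z2"
    and sm: "summable (\<lambda>j. indicator A (Suc j ^ q) * part_prob z1 z2 (Suc j ^ q))"
  defines "m \<equiv> (\<Sum>j. indicator A (Suc j ^ q) * part_prob z1 z2 (Suc j ^ q))"
  shows "norm (measure_pmf.expectation (boltzmann q z1 z2) (\<lambda>p. iexp (s * real (card (set p \<inter> A))))
     - exp (of_real m * (iexp s - 1))) \<le> exp 2 * s\<^sup>2 * z2 * m"
proof -
  let ?u = "\<lambda>l. if l \<in> A then iexp s else 1"
  let ?p = "\<lambda>j. part_prob z1 z2 (Suc j ^ q)"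
  let ?pA = "\<lambda>j. indicator A (Suc j ^ q) * part_prob z1 z2 (Suc j ^ q) :: real"
  note pn = part_prob_nonneg[OF z(1,3)]
  have "(\<Prod>l\<in>set p. ?u l) = iexp (s * real (card (set p \<inter> A)))" for p
    by (simp add: prod.If_cases exp_of_nat_mult[symmetric] mult_ac)
  hence lim1: "(\<lambda>n. \<Prod>j<n. 1 + of_real (?p j) * (?u (Suc j ^ q) - 1))
     \<longlonglongrightarrow> measure_pmf.expectation (boltzmann q z1 z2) (\<lambda>p. iexp (s * real (card (set p \<inter> A))))"
    using boltzmann_prod_limit[OF q z, of ?u] by simp
  \<comment> \<open>Parts outside \<open>A\<close> contribute the factor 1, so they can be treated
    as having success probability 0.\<close>
  have eq: "1 + of_real (?p j) * (?u (Suc j ^ q) - 1) = 1 + of_real (?pA j) * (iexp s - 1)" for j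
    by (simp add: indicator_def)
  have "(\<lambda>n. \<Sum>j<n. ?pA j) \<longlonglongrightarrow> m" unfolding m_def using sm by (rule summable_LIMSEQ)
  hence "(\<lambda>n. exp (of_real (\<Sum>j<n. ?pA j) * (iexp s - 1))) \<longlonglongrightarrow> exp (of_real m * (iexp s - 1))"
    by (intro tendsto_intros)
  from tendsto_norm[OF tendsto_diff[OF lim1 this]] show ?thesis
  proof (rule tendsto_upperbound)
    show "\<forall>\<^sub>F n in sequentially. norm ((\<Prod>j<n. 1 + of_real (?p j) * (?u (Suc j ^ q) - 1))
       - exp (of_real (\<Sum>j<n. ?pA j) * (iexp s - 1))) \<le> exp 2 * s\<^sup>2 * z2 * m"
    proof (intro always_eventually allI)
      fix n
      have pA: "0 \<le> ?pA j" "?pA j \<le> 1" "?pA j \<le> z2" for j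
      proof -
        have "z1 ^ (Suc j ^ q) * z2 \<le> z2" using z by (simp add: mult_le_cancel_right1 power_le_one)
        hence "part_prob z1 z2 (Suc j ^ q) \<le> z2"
          using part_prob_le[OF z(1,3), of "Suc j ^ q"] by linarith
        thus "?pA j \<le> z2" using z by (simp add: indicator_def)
      qed (use pn part_prob_le_1[OF z(1,3)] in \<open>auto simp: indicator_def\<close>)
      have "exp (of_real (\<Sum>j<n. ?pA j) * (iexp s - 1)) = (\<Prod>j<n. exp (of_real (?pA j) * (iexp s - 1)))"
        by (simp only: exp_sum[OF finite_lessThan, symmetric] sum_distrib_right of_real_sum)
      hence "norm ((\<Prod>j<n. 1 + of_real (?p j) * (?u (Suc j ^ q) - 1))
         - exp (of_real (\<Sum>j<n. ?pA j) * (iexp s - 1)))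
         = norm ((\<Prod>j<n. 1 + of_real (?pA j) * (iexp s - 1)) - (\<Prod>j<n. exp (of_real (?pA j) * (iexp s - 1))))"
        by (simp only: eq)
      also have "\<dots> \<le> (\<Sum>j<n. norm (1 + of_real (?pA j) * (iexp s - 1) - exp (of_real (?pA j) * (iexp s - 1))))"
      proof (rule norm_prod_diff)
        fix j assume "j \<in> {..<n}"
        show "norm (1 + of_real (?pA j) * (iexp s - 1)) \<le> 1"
          by (rule norm_one_plus_bernoulli_le) (use pA in auto)
        \<comment> \<open>The exponent has real part \<open>?pA j * (cos s - 1)\<close>, which is
          nonpositive.\<close>
        show "norm (exp (of_real (?pA j) * (iexp s - 1))) \<le> 1"
          using pA(1)[of j] by (simp add: Re_exp mult_nonneg_nonpos)
      qed
      also have "\<dots> \<le> (\<Sum>j<n. exp 2 * s\<^sup>2 * z2 * ?pA j)"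
      proof (rule sum_mono)
        fix j
        have "norm (1 + of_real (?pA j) * (iexp s - 1) - exp (of_real (?pA j) * (iexp s - 1)))
            \<le> exp 2 * s\<^sup>2 * (?pA j)\<^sup>2" by (rule norm_exp_bernoulli_diff_le) (use pA in auto)
        also have "\<dots> \<le> exp 2 * s\<^sup>2 * (z2 * ?pA j)"
          unfolding power2_eq_square[of "?pA j"]
          using pA by (intro mult_left_mono mult_right_mono) auto
        finally show "norm (1 + of_real (?pA j) * (iexp s - 1) - exp (of_real (?pA j) * (iexp s - 1)))
            \<le> exp 2 * s\<^sup>2 * z2 * ?pA j" by (simp add: mult_ac)
      qed
      also have "\<dots> = exp 2 * s\<^sup>2 * z2 * (\<Sum>j<n. ?pA j)" by (rule sum_distrib_left[symmetric])
      also have "\<dots> \<le> exp 2 * s\<^sup>2 * z2 * m"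
        unfolding m_def using z pA sm by (intro mult_left_mono sum_le_suminf) auto
      finally show "norm ((\<Prod>j<n. 1 + of_real (?p j) * (?u (Suc j ^ q) - 1))
         - exp (of_real (\<Sum>j<n. ?pA j) * (iexp s - 1))) \<le> exp 2 * s\<^sup>2 * z2 * m" .
    qed
  qed simp
qed

subsection \<open>Riemann sums on the half-line\<close>

text \<open>The integrand is a step function, constant on each interval
  \<open>{h * real j<..h * real (Suc j)}\<close> of length \<open>h\<close>. The intervals are open
  on the left so that the ceiling is \<open>Suc j\<close> throughout. As an integral, the series
  becomes accessible to dominated convergence.\<close>

lemma suminf_eq_set_integral_ceiling:
  fixes f :: "real \<Rightarrow> real"
  assumes h: "0 < h" and int: "set_integrable lborel {0<..} (\<lambda>y. f (h * of_int \<lceil>y / h\<rceil>))"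
  shows "(\<Sum>j. h * f (h * real (Suc j))) = (LINT y:{0<..}|lborel. f (h * of_int \<lceil>y / h\<rceil>))"
proof -
  define A where "A j = {h * real j<..h * real (Suc j)}" for j
  have ceil: "\<lceil>y / h\<rceil> = int (Suc j)" if "y \<in> A j" for y j
    using that h by (intro ceiling_unique) (auto simp: A_def field_simps)
  have UN: "(\<Union>j. A j) = {0<..}"
  proof (intro equalityI subsetI)
    fix y :: real assume "y \<in> {0<..}"
    hence y: "0 < y" by simp
    define j where "j = nat (\<lceil>y / h\<rceil> - 1)"
    have "0 < \<lceil>y / h\<rceil>" using y h by simp
    hence j: "real j = of_int \<lceil>y / h\<rceil> - 1" by (simp add: j_def of_nat_nat)
    have "real j < y / h" "y / h \<le> real j + 1" using j by linarith+
    hence "y \<in> A j" using h by (simp add: A_def field_simps)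
    thus "y \<in> (\<Union>j. A j)" by blast
  next
    fix y assume "y \<in> (\<Union>j. A j)"
    then obtain j where "y \<in> A j" by blast
    hence "h * real j < y" by (simp add: A_def)
    moreover have "0 \<le> h * real j" using h by simp
    ultimately have "0 < y" by linarith
    thus "y \<in> {0<..}" by simp
  qed
  have "(LINT y:{0<..}|lborel. f (h * of_int \<lceil>y / h\<rceil>))
      = (\<Sum>j. LINT y:A j|lborel. f (h * of_int \<lceil>y / h\<rceil>))"
    unfolding UN[symmetric]
  proof (rule lebesgue_integral_countable_add)
    show "A i \<inter> A j = {}" if "i \<noteq> j" for i j
    proof (rule ccontr)
      assume "A i \<inter> A j \<noteq> {}"
      then obtain y where "y \<in> A i" "y \<in> A j" by blast
      with ceil[of y i] ceil[of y j] that show False by simp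
    qed
  qed (use int UN in \<open>auto simp: A_def\<close>)
  also have "(\<lambda>j. LINT y:A j|lborel. f (h * of_int \<lceil>y / h\<rceil>)) = (\<lambda>j. h * f (h * real (Suc j)))"
  proof
    fix j
    have "(LINT y:A j|lborel. f (h * of_int \<lceil>y / h\<rceil>)) = (LINT y:A j|lborel. f (h * real (Suc j)))"
      by (rule set_lebesgue_integral_cong) (auto simp: A_def ceil[unfolded A_def])
    also have "\<dots> = measure lborel (A j) * f (h * real (Suc j))"
      using h by (subst set_integral_const) (auto simp: A_def)
    also have "measure lborel (A j) = h" using h by (simp add: A_def algebra_simps)
    finally show "(LINT y:A j|lborel. f (h * of_int \<lceil>y / h\<rceil>)) = h * f (h * real (Suc j))" .
  qed
  finally show ?thesis by simp
qed

text \<open>Dominated convergence for the step functions. The ceiling moves the argument to the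
  right, so a decreasing majorant \<open>G\<close> of \<open>f n\<close> also dominates the step
  function at \<open>y\<close>. Convergence almost everywhere leaves room for a jump of the
  limit.\<close>

lemma riemann_sum_tendsto_integral:
  fixes f :: "nat \<Rightarrow> real \<Rightarrow> real" and h :: "nat \<Rightarrow> real"
  assumes h: "\<And>n. 0 < h n"
    and [measurable]: "\<And>n. f n \<in> borel_measurable borel" "g \<in> borel_measurable borel"
    and G: "set_integrable lborel {0<..} G" "\<And>x y. 0 < x \<Longrightarrow> x \<le> y \<Longrightarrow> G y \<le> G x"
    and dom: "\<And>n y. 0 < y \<Longrightarrow> \<bar>f n y\<bar> \<le> G y"
    and lim: "AE y in lborel. 0 < y \<longrightarrow> (\<lambda>n. f n (h n * of_int \<lceil>y / h n\<rceil>)) \<longlonglongrightarrow> g y"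
  shows "(\<lambda>n. \<Sum>j. h n * f n (h n * real (Suc j))) \<longlonglongrightarrow> integral {0<..} g"
proof -
  let ?F = "\<lambda>n y. indicator {0<..} y *\<^sub>R f n (h n * of_int \<lceil>y / h n\<rceil>)"
  let ?g = "\<lambda>y. indicator {0<..} y *\<^sub>R g y"
  let ?G = "\<lambda>y. indicator {0<..} y *\<^sub>R G y"
  have G': "integrable lborel ?G" using G(1) by (simp add: set_integrable_def)
  have lim': "AE y in lborel. (\<lambda>n. ?F n y) \<longlonglongrightarrow> ?g y"
    using lim by eventually_elim (auto split: split_indicator)
  have bound: "AE y in lborel. norm (?F n y) \<le> ?G y" for n
  proof (intro AE_I2)
    fix y :: real
    have "\<bar>f n (h n * of_int \<lceil>y / h n\<rceil>)\<bar> \<le> G y" if "0 < y"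
    proof -
      have "y / h n \<le> of_int \<lceil>y / h n\<rceil>" by (rule le_of_int_ceiling)
      hence "y \<le> h n * of_int \<lceil>y / h n\<rceil>"
        unfolding pos_divide_le_eq[OF h] by (simp only: mult.commute)
      with dom[of "h n * of_int \<lceil>y / h n\<rceil>" n] G(2)[of y "h n * of_int \<lceil>y / h n\<rceil>"] that
      show ?thesis by linarith
    qed
    thus "norm (?F n y) \<le> ?G y" by (simp split: split_indicator)
  qed
  have meas: "?F n \<in> borel_measurable lborel" "?g \<in> borel_measurable lborel" for n by measurable
  have int: "integrable lborel (?F n)" "integrable lborel ?g" for n
    using integrable_dominated_convergence2[OF meas(2,1) G' lim' bound]
      integrable_dominated_convergence[OF meas(2,1) G' lim' bound] by blast+
  have "(\<lambda>n. \<integral>y. ?F n y \<partial>lborel) \<longlonglongrightarrow> (\<integral>y. ?g y \<partial>lborel)"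
    by (rule integral_dominated_convergence[OF meas(2,1) G' lim' bound])
  moreover have "(\<integral>y. ?g y \<partial>lborel) = integral {0<..} g"
    using set_borel_integral_eq_integral(2)[of "{0<..}" g] int(2)
    by (simp add: set_integrable_def set_lebesgue_integral_def)
  moreover have "(\<integral>y. ?F n y \<partial>lborel) = (\<Sum>j. h n * f n (h n * real (Suc j)))" for n
    using suminf_eq_set_integral_ceiling[OF h, of "f n" n] int(1)
    by (simp add: set_integrable_def set_lebesgue_integral_def)
  ultimately show ?thesis by simp
qed

lemma mult_ceiling_tendsto:
  fixes h :: "nat \<Rightarrow> real"
  assumes "\<And>n. 0 < h n" "h \<longlonglongrightarrow> 0"
  shows "(\<lambda>n. h n * of_int \<lceil>y / h n\<rceil>) \<longlonglongrightarrow> y"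
proof (rule tendsto_sandwich[where f = "\<lambda>_. y" and h = "\<lambda>n. y + h n"])
  have "y \<le> h n * of_int \<lceil>y / h n\<rceil> \<and> h n * of_int \<lceil>y / h n\<rceil> \<le> y + h n" for n
  proof -
    have "y / h n \<le> of_int \<lceil>y / h n\<rceil>" "of_int \<lceil>y / h n\<rceil> - 1 \<le> y / h n" by linarith+
    thus ?thesis unfolding pos_divide_le_eq[OF assms(1)] pos_le_divide_eq[OF assms(1)]
      by (simp add: algebra_simps)
  qed
  thus "\<forall>\<^sub>F n in sequentially. y \<le> h n * of_int \<lceil>y / h n\<rceil>"
    "\<forall>\<^sub>F n in sequentially. h n * of_int \<lceil>y / h n\<rceil> \<le> y + h n" by auto
  show "(\<lambda>n. y + h n) \<longlonglongrightarrow> y" using tendsto_add[OF tendsto_const assms(2), of y] by simp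
qed simp

text \<open>A decreasing integrable majorant that serves every exponent \<open>q\<close> and every
  weight up to \<open>1 + u\<close>, hence length, weight and tail sums alike. It rests on
  \<open>1 + u \<le> 2 * exp (u / 2)\<close> and \<open>y - 1 \<le> y ^ q\<close>.\<close>

lemma one_plus_mult_exp_power_le:
  fixes y :: real
  assumes "0 \<le> y" "1 \<le> q"
  shows "(1 + y ^ q) * exp (- (y ^ q)) \<le> 2 * exp ((1 - y) / 2)"
proof -
  have y: "y - 1 \<le> y ^ q"
  proof (cases "1 \<le> y")
    case True
    with assms(2) show ?thesis using self_le_power[of y q] by linarith
  next
    case False
    with assms(1) show ?thesis using zero_le_power[of y q] by linarith
  qed
  have "1 + y ^ q \<le> 2 * exp (y ^ q / 2)" using exp_ge_add_one_self[of "y ^ q / 2"] by linarith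
  hence "(1 + y ^ q) * exp (- (y ^ q)) \<le> 2 * exp (y ^ q / 2) * exp (- (y ^ q))"
    by (intro mult_right_mono) auto
  also have "\<dots> = 2 * exp (- (y ^ q) / 2)" by (simp add: exp_add[symmetric])
  also have "\<dots> \<le> 2 * exp ((1 - y) / 2)" using y by simp
  finally show ?thesis .
qed

lemma set_integrable_exp_half: "set_integrable lborel {0<..} (\<lambda>y::real. 2 * exp ((1 - y) / 2))"
proof -
  have "(\<lambda>y. exp (- (1/2) * y) :: real) integrable_on {0..}"
    by (rule integrable_on_exp_minus_to_infinity) simp
  hence "(\<lambda>y::real. exp (- (1/2) * y)) absolutely_integrable_on {0..}"
    by (intro nonnegative_absolutely_integrable_1) auto
  hence "set_integrable lborel {0..} (\<lambda>y::real. exp (- (1/2) * y))"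
    unfolding set_integrable_def by (subst (asm) integrable_completion) auto
  hence "set_integrable lborel {0<..} (\<lambda>y::real. exp (- (1/2) * y))"
    by (rule set_integrable_subset) auto
  hence "set_integrable lborel {0<..} (\<lambda>y::real. (2 * exp (1/2)) * exp (- (1/2) * y))"
    by (intro set_integrable_mult_right) auto
  thus ?thesis by (simp add: exp_add[symmetric] diff_divide_distrib mult.assoc)
qed

text \<open>Substitution \<open>y = u powr (1 / q)\<close>, whose Jacobian produces the Gamma-type
  density together with the factor \<open>1 / q\<close>.\<close>

lemma integral_power_substitution:
  fixes \<phi> :: "real \<Rightarrow> real"
  assumes q: "1 \<le> q" and S: "S \<in> sets lebesgue" "S \<subseteq> {0<..}"
    and nonneg: "\<And>u. u \<in> S \<Longrightarrow> 0 \<le> \<phi> u"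
    and int: "(\<lambda>u. u powr (1 / real q - 1) * \<phi> u) integrable_on S"
  shows "integral {y. 0 < y \<and> y ^ q \<in> S} (\<lambda>y. \<phi> (y ^ q))
    = integral S (\<lambda>u. u powr (1 / real q - 1) * \<phi> u) / real q"
proof -
  let ?a = "1 / real q"
  let ?g = "\<lambda>u. u powr ?a" and ?g' = "\<lambda>u. ?a * u powr (?a - 1)"
  have pow: "(u powr ?a) ^ q = u" if "0 < u" for u
    using q that by (simp add: powr_realpow[symmetric] powr_powr)
  have T: "?g ` S = {y. 0 < y \<and> y ^ q \<in> S}"
  proof (intro equalityI subsetI)
    fix y assume "y \<in> {y. 0 < y \<and> y ^ q \<in> S}"
    moreover from this have "y = ?g (y ^ q)" using q by (simp add: powr_realpow[symmetric] powr_powr)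
    ultimately show "y \<in> ?g ` S" by blast
  qed (use S(2) pow in auto)
  have eq: "\<bar>?g' u\<bar> * \<phi> (?g u ^ q) = ?a * (u powr (?a - 1) * \<phi> u)" if "u \<in> S" for u
    using that S(2) pow[of u] by (auto simp: abs_mult)
  \<comment> \<open>Nonnegativity upgrades gauge integrability to the absolute integrability
    required by the change of variables.\<close>
  have "(\<lambda>u. ?a * (u powr (?a - 1) * \<phi> u)) absolutely_integrable_on S"
    using nonneg int by (intro nonnegative_absolutely_integrable_1 integrable_on_mult_right) auto
  hence "(\<lambda>u. \<bar>?g' u\<bar> * \<phi> (?g u ^ q)) absolutely_integrable_on S"
    by (subst set_integrable_cong[OF refl refl eq]) simp_all
  moreover have "(?g has_field_derivative ?g' u) (at u within S)" if "u \<in> S" for u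
    using that S(2) by (auto intro!: derivative_eq_intros)
  moreover have "inj_on ?g S"
    by (rule inj_onI) (metis S(2) greaterThan_iff pow subsetD)
  ultimately have "integral (?g ` S) (\<lambda>y. \<phi> (y ^ q)) = integral S (\<lambda>u. \<bar>?g' u\<bar> * \<phi> (?g u ^ q))"
    using has_absolute_integral_change_of_variables_1'[OF S(1), of ?g ?g' "\<lambda>y. \<phi> (y ^ q)"] by blast
  also have "\<dots> = integral S (\<lambda>u. ?a * (u powr (?a - 1) * \<phi> u))" by (rule integral_cong[OF eq])
  finally show ?thesis unfolding T by simp
qed

subsection \<open>Sums over the calibrated distribution\<close>

lemma power_eq_exp_neg_ln:
  fixes z :: real
  assumes "0 < z"
  shows "z ^ l = exp (- ((- ln z) * real l))"
  using assms by (simp add: exp_of_nat2_mult)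

text \<open>This is the choice of mesh: with step \<open>(- ln z) powr (1 / q)\<close>, the exponent
  belonging to the part \<open>Suc j ^ q\<close> is exactly the q-th power of a lattice
  point.\<close>

lemma scale_power_eq:
  assumes "1 \<le> q" "0 < z" "z < 1"
  shows "((- ln z) powr (1 / real q) * real (Suc j)) ^ q = (- ln z) * real (Suc j ^ q)"
proof -
  have "0 < - ln z" using assms by simp
  hence "((- ln z) powr (1 / real q)) ^ q = - ln z"
    using assms(1) by (simp add: powr_realpow[symmetric] powr_powr del: neg_0_less_iff_less)
  thus ?thesis by (simp add: power_mult_distrib)
qed

lemma part_prob_exp_le:
  assumes q: "1 \<le> q" and z: "0 < z1" "z1 < 1" "0 < z2"
  defines "h \<equiv> (- ln z1) powr (1 / real q)"
  shows "(1 + (- ln z1) * real (Suc j ^ q)) * part_prob z1 z2 (Suc j ^ q)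
     \<le> z2 * (2 * exp ((1 - h * real (Suc j)) / 2))"
proof -
  let ?u = "(- ln z1) * real (Suc j ^ q)"
  have u: "?u = (h * real (Suc j)) ^ q" unfolding h_def using scale_power_eq[OF q z(1,2)] by simp
  have "(1 + ?u) * part_prob z1 z2 (Suc j ^ q) \<le> (1 + ?u) * (z1 ^ (Suc j ^ q) * z2)"
  proof (rule mult_left_mono[OF part_prob_le[OF z(1,3)]])
    have "0 \<le> - ln z1" using z by simp
    thus "0 \<le> 1 + ?u" by (intro add_nonneg_nonneg mult_nonneg_nonneg) auto
  qed
  also have "\<dots> = z2 * ((1 + ?u) * exp (- ?u))"
    by (simp only: power_eq_exp_neg_ln[OF z(1)] mult_ac)
  also have "\<dots> \<le> z2 * (2 * exp ((1 - h * real (Suc j)) / 2))"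
    unfolding u using z q by (intro mult_left_mono one_plus_mult_exp_power_le) (auto simp: h_def)
  finally show ?thesis .
qed

lemma exp_half_eq_geometric:
  "exp ((1 - h * real (Suc j)) / 2) = exp ((1 - h) / 2) * exp (- h / 2) ^ j"
  by (simp add: exp_of_nat_mult[symmetric] exp_add[symmetric] field_simps)

lemma summable_exp_half: "0 < h \<Longrightarrow> summable (\<lambda>j. exp ((1 - h * real (Suc j)) / 2))"
  unfolding exp_half_eq_geometric by (intro summable_mult summable_geometric) simp

text \<open>The series is geometric with sum \<open>exp (1 / 2) / (exp (h / 2) - 1)\<close>, and
  \<open>exp (h / 2) - 1\<close> is at least \<open>h / 2\<close>.\<close>

lemma suminf_exp_half_le:
  assumes "0 < h"
  shows "(\<Sum>j. exp ((1 - h * real (Suc j)) / 2)) \<le> 2 * exp (1 / 2) / h"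
proof -
  have "(\<Sum>j. exp ((1 - h * real (Suc j)) / 2)) = exp ((1 - h) / 2) * (1 / (1 - exp (- h / 2)))"
    unfolding exp_half_eq_geometric using assms by (subst suminf_mult) (simp_all add: suminf_geometric)
  also have "\<dots> = exp (1 / 2) / (exp (h / 2) - 1)"
  proof -
    define e where "e = exp (h / 2)"
    have "1 < e" using assms by (simp add: e_def)
    have eq: "exp ((1 - h) / 2) = exp (1 / 2) / e" "exp (- h / 2) = 1 / e"
      by (simp_all add: e_def diff_divide_distrib exp_diff exp_minus inverse_eq_divide)
    show ?thesis unfolding e_def[symmetric] eq using \<open>1 < e\<close> by (simp add: field_simps)
  qed
  also have "\<dots> \<le> exp (1 / 2) / (h / 2)"
  proof -
    have "h / 2 \<le> exp (h / 2) - 1" using exp_ge_add_one_self[of "h / 2"] by linarith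
    thus ?thesis using assms by (intro divide_left_mono mult_pos_pos) auto
  qed
  finally show ?thesis by (simp add: mult.commute)
qed

lemma summable_part_prob_weighted:
  assumes q: "1 \<le> q" and z: "0 < z1" "z1 < 1" "0 < z2"
  shows "summable (\<lambda>j. (1 + (- ln z1) * real (Suc j ^ q)) * part_prob z1 z2 (Suc j ^ q))"
proof (rule summable_comparison_test')
  have "0 < - ln z1" using z by simp
  hence "0 < (- ln z1) powr (1 / real q)" by simp
  from summable_mult[OF summable_mult[OF summable_exp_half[OF this], of 2], of z2]
  show "summable (\<lambda>j. z2 * (2 * exp ((1 - (- ln z1) powr (1 / real q) * real (Suc j)) / 2)))" .
  have "0 \<le> (1 + (- ln z1) * real (Suc j ^ q)) * part_prob z1 z2 (Suc j ^ q)" for j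
    using part_prob_nonneg[OF z(1,3)] \<open>0 < - ln z1\<close>
    by (intro mult_nonneg_nonneg add_nonneg_nonneg) auto
  thus "norm ((1 + (- ln z1) * real (Suc j ^ q)) * part_prob z1 z2 (Suc j ^ q))
      \<le> z2 * (2 * exp ((1 - (- ln z1) powr (1 / real q) * real (Suc j)) / 2))" for j
    using part_prob_exp_le[OF q z, of j] by simp
qed

text \<open>Common source of summability for the length (\<open>b = 1\<close>), the weight
  (\<open>b\<close> linear) and the tail (\<open>b\<close> an indicator).\<close>

lemma summable_part_prob_mult:
  assumes q: "1 \<le> q" and z: "0 < z1" "z1 < 1" "0 < z2"
    and b: "\<And>l. 0 \<le> b l" "\<And>l. b l \<le> 1 + (- ln z1) * real l"
  shows "summable (\<lambda>j. b (Suc j ^ q) * part_prob z1 z2 (Suc j ^ q))"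
proof (rule summable_comparison_test'[OF summable_part_prob_weighted[OF q z]])
  fix j
  show "norm (b (Suc j ^ q) * part_prob z1 z2 (Suc j ^ q))
     \<le> (1 + (- ln z1) * real (Suc j ^ q)) * part_prob z1 z2 (Suc j ^ q)"
    using part_prob_nonneg[OF z(1,3), of "Suc j ^ q"] b(1) mult_right_mono[OF b(2)]
    by (simp only: real_norm_def abs_mult abs_of_nonneg)
qed

lemma summable_part_prob:
  assumes q: "1 \<le> q" and z: "0 < z1" "z1 < 1" "0 < z2"
  shows "summable (\<lambda>j. part_prob z1 z2 (Suc j ^ q))"
  using summable_part_prob_mult[OF assms, of "\<lambda>_. 1"] z by (simp add: mult_nonpos_nonneg)

lemma summable_mult_part_prob:
  assumes q: "1 \<le> q" and z: "0 < z1" "z1 < 1" "0 < z2"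
  shows "summable (\<lambda>j. real (Suc j ^ q) * part_prob z1 z2 (Suc j ^ q))"
proof -
  have pos: "0 < - ln z1" using z by simp
  have "summable (\<lambda>j. ((- ln z1) * real (Suc j ^ q)) * part_prob z1 z2 (Suc j ^ q))"
    using pos by (intro summable_part_prob_mult[OF assms, of "\<lambda>l. (- ln z1) * real l"])
      (simp_all add: mult_nonpos_nonneg)
  from summable_mult[OF this, of "1 / (- ln z1)"] show ?thesis using pos by (simp add: mult.assoc)
qed

lemma count_list_strict_partition:
  assumes "p \<in> strict_partitions q" "l \<in> set p"
  shows "count_list p l = 1"
proof -
  have "distinct xs \<Longrightarrow> l \<in> set xs \<Longrightarrow> count_list xs l = 1" for xs :: "nat list"
    by (induction xs) (auto simp: count_list_0_iff)
  thus ?thesis using distinct_strict_partition[OF assms(1)] assms(2) by blast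
qed

text \<open>Multiplicities being 0 or 1, weight and length are additive over the parts, so the
  calibration turns into two explicit series in \<open>z1\<close> and \<open>z2\<close>.\<close>

lemma calibrated_sums:
  assumes q: "1 \<le> q" and cal: "calibrated q N M z1 z2"
  shows "(\<Sum>j. part_prob z1 z2 (Suc j ^ q)) = M"
    and "(\<Sum>j. real (Suc j ^ q) * part_prob z1 z2 (Suc j ^ q)) = N"
proof -
  have z: "0 < z1" "z1 < 1" "0 < z2" using cal by (simp_all add: calibrated_def)
  let ?E = "measure_pmf.expectation (boltzmann q z1 z2)"
  have "?E (\<lambda>p. real (part_length p)) = ?E (\<lambda>p. \<Sum>l\<in>set p. 1)"
    using set_pmf_boltzmann[OF z, of q]
    by (intro integral_cong_AE) (auto simp: AE_measure_pmf_iff part_length_def count_list_strict_partition)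
  also have "\<dots> = (\<Sum>j. part_prob z1 z2 (Suc j ^ q))"
    using expectation_additive[OF q z, of "\<lambda>_. 1"] summable_part_prob[OF q z] by simp
  finally show "(\<Sum>j. part_prob z1 z2 (Suc j ^ q)) = M" using cal by (simp add: calibrated_def)
  have "?E (\<lambda>p. real (part_weight p)) = ?E (\<lambda>p. \<Sum>l\<in>set p. real l)"
    using set_pmf_boltzmann[OF z, of q]
    by (intro integral_cong_AE) (auto simp: AE_measure_pmf_iff part_weight_def count_list_strict_partition)
  also have "\<dots> = (\<Sum>j. real (Suc j ^ q) * part_prob z1 z2 (Suc j ^ q))"
    by (rule expectation_additive[OF q z _ summable_mult_part_prob[OF q z]]) simp
  finally show "(\<Sum>j. real (Suc j ^ q) * part_prob z1 z2 (Suc j ^ q)) = N"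
    using cal by (simp add: calibrated_def)
qed

section \<open>Bounding the expected weight when the fugacity is not small\<close>

lemma part_prob_antimono:
  assumes z: "0 < z1" "z1 < 1" "0 < z2" and "l \<le> k"
  shows "part_prob z1 z2 k \<le> part_prob z1 z2 l"
proof -
  have "z1 ^ k * z2 \<le> z1 ^ l * z2" using assms by (intro mult_right_mono power_decreasing) auto
  moreover have "0 < 1 + z1 ^ k * z2" "0 < 1 + z1 ^ l * z2" using z by (auto intro: add_pos_pos)
  ultimately show ?thesis by (simp add: part_prob_def divide_le_eq le_divide_eq field_simps)
qed

text \<open>If \<open>z2\<close> stays away from 0, then the success probabilities decay on the scale \<open>K \<approx> M\<close> of their
  number, so that \<open>N\<close> is at most of order \<open>M ^ (q + 1)\<close>.\<close>

lemma calibrated_weight_le: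
  assumes q: "1 \<le> q" and cal: "calibrated q N M z1 z2" and d: "0 < d" "d \<le> 1" "d \<le> z2"
    and K: "1 \<le> K" "(1 + exp 1 / d) * M \<le> real K"
  shows "N \<le> 4 * exp (3 / 2) * real K ^ (q + 1)"
proof -
  have z: "0 < z1" "z1 < 1" "0 < z2" using cal by (simp_all add: calibrated_def)
  let ?p = "part_prob z1 z2"
  note pn = part_prob_nonneg[OF z(1,3)]
  define w where "w = z1 ^ (K ^ q) * z2"
  have w_pos: "0 < w" using z by (simp add: w_def)
  \<comment> \<open>The success probabilities decrease, so the first \<open>K\<close> of them are
    all at least \<open>?p (K ^ q)\<close>, while their total is at most \<open>M\<close>.\<close>
  have "real K * ?p (K ^ q) = (\<Sum>j<K. ?p (K ^ q))" by simp
  also have "\<dots> \<le> (\<Sum>j<K. ?p (Suc j ^ q))"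
    by (intro sum_mono part_prob_antimono[OF z] power_mono) auto
  also have "\<dots> \<le> (\<Sum>j. ?p (Suc j ^ q))"
    by (rule sum_le_suminf[OF summable_part_prob[OF q z]]) (auto simp: pn)
  also have "\<dots> = M" by (rule calibrated_sums[OF q cal])
  finally have KM: "real K * ?p (K ^ q) \<le> M" .
  \<comment> \<open>The constant \<open>1 + exp 1 / d\<close> is chosen so that
    \<open>w / (1 + w) \<le> 1 / (1 + exp 1 / d)\<close>, that is \<open>w \<le> d / exp 1\<close>.
    Since \<open>d \<le> z2\<close>, this gives \<open>z1 ^ (K ^ q) \<le> exp (- 1)\<close>.\<close>
  have "(1 + exp 1 / d) * (real K * ?p (K ^ q)) \<le> real K"
    using order_trans[OF mult_left_mono[OF KM] K(2)] d(1) by simp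
  hence "real K * ((1 + exp 1 / d) * ?p (K ^ q)) \<le> real K * 1" by (simp only: mult_ac mult_1_right)
  hence "(1 + exp 1 / d) * ?p (K ^ q) \<le> 1" by (rule mult_left_le_imp_le) (use K(1) in simp)
  hence "(1 + exp 1 / d) * w \<le> 1 + w"
    using w_pos unfolding part_prob_def w_def[symmetric] by (simp add: divide_le_eq)
  hence w_le: "w \<le> d / exp 1" using d by (simp add: field_simps)
  have "z1 ^ (K ^ q) * d \<le> w" using d z by (simp add: w_def)
  hence "z1 ^ (K ^ q) * d \<le> exp (- 1) * d" using w_le by (simp add: exp_minus divide_inverse mult.commute)
  hence z_le: "z1 ^ (K ^ q) \<le> exp (- 1)" using d(1) by (rule mult_right_le_imp_le)
  define h where "h = 1 / real K"
  have h: "0 < h" using K(1) by (simp add: h_def)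
  have Kq: "0 < real (K ^ q)" using K(1) by simp
  have ln_le: "ln z1 * real (K ^ q) \<le> - 1"
    using z_le unfolding power_eq_exp_neg_ln[OF z(1)] exp_le_cancel_iff by simp
  \<comment> \<open>The exponent on the right is \<open>Suc j ^ q / K ^ q\<close>. Below
    \<open>K\<close> it is at most 1, so the right-hand side is at least 1. From \<open>K\<close>
    on, the bound starts at \<open>w \<le> 1\<close> and decays at rate at least
    \<open>1 / K ^ q\<close>, because \<open>ln z1 * K ^ q \<le> - 1\<close>.\<close>
  have p_le: "?p (Suc j ^ q) \<le> exp 1 * exp (- ((h * real (Suc j)) ^ q))" for j
  proof (cases "K \<le> Suc j")
    case False
    have "(h * real (Suc j)) ^ q \<le> 1 ^ q"
      using False K(1) by (intro power_mono) (auto simp: h_def)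
    hence "1 \<le> exp 1 * exp (- ((h * real (Suc j)) ^ q))" by (simp add: exp_add[symmetric])
    with part_prob_le_1[OF z(1,3), of "Suc j ^ q"] show ?thesis by linarith
  next
    case True
    define r where "r = real (Suc j ^ q) - real (K ^ q)"
    have r: "0 \<le> r" unfolding r_def using True power_mono[of K "Suc j" q] by (simp flip: of_nat_power)
    have "?p (Suc j ^ q) \<le> z1 ^ (Suc j ^ q) * z2" by (rule part_prob_le[OF z(1,3)])
    also have "\<dots> = w * exp (ln z1 * r)"
      unfolding w_def power_eq_exp_neg_ln[OF z(1)] r_def by (simp add: exp_add[symmetric] algebra_simps)
    also have "\<dots> \<le> 1 * exp (- r / real (K ^ q))"
    proof (intro mult_mono)
      have "d / exp 1 \<le> 1" using d by (simp add: divide_le_eq order_trans[OF d(2)])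
      thus "w \<le> 1" using w_le by linarith
      have "ln z1 * real (K ^ q) * r \<le> - r" using mult_right_mono[OF ln_le r] by simp
      hence "ln z1 * r * real (K ^ q) \<le> - r" by (simp only: mult_ac)
      thus "exp (ln z1 * r) \<le> exp (- r / real (K ^ q))"
        by (simp only: pos_le_divide_eq[OF Kq] exp_le_cancel_iff)
    qed auto
    also have "- r / real (K ^ q) = 1 - (h * real (Suc j)) ^ q"
      using Kq by (simp add: r_def h_def power_divide field_simps)
    finally show ?thesis by (simp add: exp_diff exp_minus divide_inverse)
  qed
  have "real (Suc j ^ q) * ?p (Suc j ^ q) \<le> real (K ^ q) * exp 1 * (2 * exp ((1 - h * real (Suc j)) / 2))" for j
  proof -
    let ?u = "(h * real (Suc j)) ^ q"
    have u: "real (Suc j ^ q) = real (K ^ q) * ?u" using K(1) by (simp add: h_def power_divide)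
    have "real (Suc j ^ q) * ?p (Suc j ^ q) \<le> real (Suc j ^ q) * (exp 1 * exp (- ?u))"
      by (rule mult_left_mono[OF p_le]) simp
    also have "\<dots> = real (K ^ q) * exp 1 * (?u * exp (- ?u))" by (simp only: u mult_ac)
    also have "?u * exp (- ?u) \<le> (1 + ?u) * exp (- ?u)" by (intro mult_right_mono) auto
    also have "\<dots> \<le> 2 * exp ((1 - h * real (Suc j)) / 2)"
      using h q by (intro one_plus_mult_exp_power_le) auto
    finally show ?thesis by (simp add: mult_left_mono)
  qed
  hence "(\<Sum>j. real (Suc j ^ q) * ?p (Suc j ^ q))
      \<le> (\<Sum>j. real (K ^ q) * exp 1 * (2 * exp ((1 - h * real (Suc j)) / 2)))"
    by (intro suminf_le summable_mult_part_prob[OF q z] summable_mult summable_exp_half[OF h])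
  hence "N \<le> (\<Sum>j. real (K ^ q) * exp 1 * (2 * exp ((1 - h * real (Suc j)) / 2)))"
    by (simp only: calibrated_sums(2)[OF q cal])
  also have "\<dots> = real (K ^ q) * exp 1 * 2 * (\<Sum>j. exp ((1 - h * real (Suc j)) / 2))"
    unfolding mult.assoc[symmetric] by (rule suminf_mult[OF summable_exp_half[OF h]])
  \<comment> \<open>Summation over a lattice of mesh \<open>1 / K\<close> costs a further factor of
    order \<open>K\<close>, whence the exponent \<open>q + 1\<close>.\<close>
  also have "\<dots> \<le> real (K ^ q) * exp 1 * 2 * (2 * exp (1 / 2) / h)"
    by (intro mult_left_mono suminf_exp_half_le h) auto
  also have "\<dots> = 4 * (exp 1 * exp (1 / 2)) * real K ^ (q + 1)" by (simp add: h_def)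
  also have "exp 1 * exp (1 / 2) = exp (3 / 2 :: real)" by (simp add: exp_add[symmetric])
  finally show ?thesis .
qed

subsection \<open>Limits of the sums\<close>

text \<open>One limit theorem for the length, weight and tail sums. Divided by \<open>z2\<close>,
  the summands are lattice values of \<open>\<psi> n u * exp (- u) / (1 + z2 * exp (- u))\<close> at
  \<open>u = y ^ q\<close>, and the denominator tends to 1. The weight may vary with
  \<open>n\<close> since the tail threshold does; \<open>x\<close> is the point where its limit may
  jump.\<close>

lemma weighted_sum_tendsto:
  fixes z1 z2 :: "nat \<Rightarrow> real" and \<psi> :: "nat \<Rightarrow> real \<Rightarrow> real" and \<psi>' :: "real \<Rightarrow> real"
  assumes q: "1 \<le> q" and z: "\<And>n. 0 < z1 n" "\<And>n. z1 n < 1" "\<And>n. 0 < z2 n"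
    and lim: "(\<lambda>n. - ln (z1 n)) \<longlonglongrightarrow> 0" "z2 \<longlonglongrightarrow> 0"
    and [measurable]: "\<And>n. \<psi> n \<in> borel_measurable borel" "\<psi>' \<in> borel_measurable borel"
    and bound: "\<And>n u. 0 \<le> u \<Longrightarrow> 0 \<le> \<psi> n u" "\<And>n u. 0 \<le> u \<Longrightarrow> \<psi> n u \<le> 1 + u"
    and conv: "\<And>v u. v \<longlonglongrightarrow> u \<Longrightarrow> 0 < u \<Longrightarrow> u \<noteq> x \<Longrightarrow> (\<lambda>n. \<psi> n (v n)) \<longlonglongrightarrow> \<psi>' u"
  shows "(\<lambda>n. (- ln (z1 n)) powr (1 / real q) / z2 n *
        (\<Sum>j. \<psi> n ((- ln (z1 n)) * real (Suc j ^ q)) * part_prob (z1 n) (z2 n) (Suc j ^ q)))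
     \<longlonglongrightarrow> integral {0<..} (\<lambda>y. \<psi>' (y ^ q) * exp (- (y ^ q)))"
proof -
  define h where "h n = (- ln (z1 n)) powr (1 / real q)" for n
  define f where "f n y = \<psi> n (y ^ q) * (exp (- (y ^ q)) / (1 + z2 n * exp (- (y ^ q))))" for n and y :: real
  have al: "0 < - ln (z1 n)" for n using z by simp
  have h_pos: "0 < h n" for n using al[of n] by (simp add: h_def)
  have "(\<lambda>n. (- ln (z1 n)) powr (1 / real q)) \<longlonglongrightarrow> 0 powr (1 / real q)"
    using q al less_imp_le[OF al] by (intro tendsto_powr'[OF lim(1) tendsto_const]) auto
  hence h_lim: "h \<longlonglongrightarrow> 0" by (simp add: h_def[abs_def])
  have den: "1 \<le> 1 + z2 n * exp v" for n v using z(3)[of n] by simp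
  have f_le: "\<bar>f n y\<bar> \<le> 2 * exp ((1 - y) / 2)" if "0 < y" for n y
  proof -
    have "0 \<le> f n y" unfolding f_def using that bound(1)[of "y ^ q" n] den[of n "- (y ^ q)"]
      by (intro mult_nonneg_nonneg divide_nonneg_nonneg) auto
    moreover have "f n y \<le> (1 + y ^ q) * exp (- (y ^ q))" unfolding f_def
    proof (intro mult_mono)
      show "exp (- (y ^ q)) / (1 + z2 n * exp (- (y ^ q))) \<le> exp (- (y ^ q))"
        using divide_left_mono[OF den[of n "- (y ^ q)"], of "exp (- (y ^ q))"] den[of n "- (y ^ q)"] by simp
      show "0 \<le> exp (- (y ^ q)) / (1 + z2 n * exp (- (y ^ q)))"
        using den[of n "- (y ^ q)"] by (intro divide_nonneg_nonneg) auto
    qed (use that bound(2)[of "y ^ q" n] in auto)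
    ultimately show ?thesis using one_plus_mult_exp_power_le[of y q] that q by linarith
  qed
  \<comment> \<open>Only the \<open>y\<close> with \<open>y ^ q = x\<close> escapes
    \<open>conv\<close>, and a single point is a null set.\<close>
  have f_conv: "AE y in lborel. 0 < y \<longrightarrow>
      (\<lambda>n. f n (h n * of_int \<lceil>y / h n\<rceil>)) \<longlonglongrightarrow> \<psi>' (y ^ q) * exp (- (y ^ q))"
    using AE_lborel_singleton[of "x powr (1 / real q)"]
  proof eventually_elim
    fix y :: real assume y: "y \<noteq> x powr (1 / real q)"
    show "0 < y \<longrightarrow> (\<lambda>n. f n (h n * of_int \<lceil>y / h n\<rceil>)) \<longlonglongrightarrow> \<psi>' (y ^ q) * exp (- (y ^ q))"
    proof
      assume "0 < y"
      hence "(y ^ q) powr (1 / real q) = y" using q by (simp add: powr_realpow[symmetric] powr_powr)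
      hence "y ^ q \<noteq> x" using y by metis
      have lim_y: "(\<lambda>n. (h n * of_int \<lceil>y / h n\<rceil>) ^ q) \<longlonglongrightarrow> y ^ q"
        by (intro tendsto_power mult_ceiling_tendsto h_pos h_lim)
      have "(\<lambda>n. f n (h n * of_int \<lceil>y / h n\<rceil>)) \<longlonglongrightarrow> \<psi>' (y ^ q) * (exp (- (y ^ q)) / (1 + 0 * exp (- (y ^ q))))"
        unfolding f_def using \<open>0 < y\<close> \<open>y ^ q \<noteq> x\<close>
        by (intro tendsto_mult conv[OF lim_y] tendsto_divide tendsto_add tendsto_const tendsto_exp
            tendsto_minus lim_y lim(2)) auto
      thus "(\<lambda>n. f n (h n * of_int \<lceil>y / h n\<rceil>)) \<longlonglongrightarrow> \<psi>' (y ^ q) * exp (- (y ^ q))" by simp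
    qed
  qed
  have "(\<lambda>n. \<Sum>j. h n * f n (h n * real (Suc j)))
      \<longlonglongrightarrow> integral {0<..} (\<lambda>y. \<psi>' (y ^ q) * exp (- (y ^ q)))"
    by (rule riemann_sum_tendsto_integral[OF h_pos _ _ set_integrable_exp_half _ f_le f_conv])
       (auto simp: f_def[abs_def])
  moreover have "(\<Sum>j. h n * f n (h n * real (Suc j))) = h n / z2 n *
      (\<Sum>j. \<psi> n ((- ln (z1 n)) * real (Suc j ^ q)) * part_prob (z1 n) (z2 n) (Suc j ^ q))" for n
  proof -
    let ?t = "\<lambda>j. \<psi> n ((- ln (z1 n)) * real (Suc j ^ q)) * part_prob (z1 n) (z2 n) (Suc j ^ q)"
    have "h n * f n (h n * real (Suc j)) = h n / z2 n * ?t j" for j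
    proof -
      have e: "(h n * real (Suc j)) ^ q = (- ln (z1 n)) * real (Suc j ^ q)"
        unfolding h_def by (rule scale_power_eq[OF q z(1,2)])
      have "f n (h n * real (Suc j)) = \<psi> n ((- ln (z1 n)) * real (Suc j ^ q)) *
          (z1 n ^ (Suc j ^ q) / (1 + z2 n * z1 n ^ (Suc j ^ q)))"
        unfolding f_def e power_eq_exp_neg_ln[OF z(1)] ..
      thus ?thesis using z(3)[of n] by (simp add: part_prob_def mult_ac del: power_Suc of_nat_power of_nat_Suc)
    qed
    moreover have "summable ?t"
    proof (rule summable_part_prob_mult[OF q z, where b = "\<lambda>l. \<psi> n ((- ln (z1 n)) * real l)"])
      fix l
      have "0 \<le> (- ln (z1 n)) * real l" using al[of n] by (intro mult_nonneg_nonneg) auto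
      thus "0 \<le> \<psi> n ((- ln (z1 n)) * real l)"
        "\<psi> n ((- ln (z1 n)) * real l) \<le> 1 + (- ln (z1 n)) * real l" by (rule bound)+
    qed
    ultimately show ?thesis by (simp only: suminf_mult)
  qed
  ultimately show ?thesis by (simp add: h_def)
qed

section \<open>Gamma integrals, the limit shape and the normal law\<close>

lemma has_integral_Gamma_greaterThan:
  fixes a :: real
  assumes "0 < a"
  shows "((\<lambda>u. u powr (a - 1) * exp (- u)) has_integral Gamma a) {0<..}"
proof -
  have "((\<lambda>u. u powr (a - 1) * exp (- u)) has_integral Gamma a) {0..}"
    using Gamma_integral_real[OF assms] by (simp add: exp_minus divide_inverse)
  moreover have "{u \<in> {0..} - {0<..}. u powr (a - 1) * exp (- u) \<noteq> 0} \<subseteq> {0}"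
    "{u \<in> {0<..} - {0..}. u powr (a - 1) * exp (- u) \<noteq> 0} \<subseteq> {0 :: real}" by auto
  hence n: "negligible {u \<in> {0..} - {0<..}. u powr (a - 1) * exp (- u) \<noteq> 0}"
    "negligible {u \<in> {0<..} - {0..}. u powr (a - 1) * exp (- u) \<noteq> (0 :: real)}"
    using negligible_subset[OF negligible_sing] by blast+
  ultimately show ?thesis using has_integral_spike_set_eq[OF n] by blast
qed

lemma integral_exp_power:
  assumes "1 \<le> q"
  shows "integral {0<..} (\<lambda>y::real. exp (- (y ^ q))) = Gamma (1 / real q) / real q"
proof -
  have T: "{y::real. 0 < y \<and> y ^ q \<in> {0<..}} = {0<..}" by auto
  have "((\<lambda>u. u powr (1 / real q - 1) * exp (- u)) has_integral Gamma (1 / real q)) {0<..}"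
    using assms by (intro has_integral_Gamma_greaterThan) simp
  thus ?thesis
    using integral_power_substitution[OF assms, of "{0<..}" "\<lambda>u. exp (- u)"]
    unfolding T by (auto simp: has_integral_iff)
qed

text \<open>The factor \<open>u\<close> raises the Gamma argument by one. The functional equation
  then yields an extra \<open>1 / q\<close> compared with the integral without this factor, which
  matches the \<open>q\<close> in the scaling \<open>A = q * N / M\<close>.\<close>

lemma integral_power_mult_exp_power:
  assumes "1 \<le> q"
  shows "integral {0<..} (\<lambda>y::real. y ^ q * exp (- (y ^ q))) = Gamma (1 / real q) / (real q)\<^sup>2"
proof -
  have T: "{y::real. 0 < y \<and> y ^ q \<in> {0<..}} = {0<..}" by auto
  have "((\<lambda>u. u powr (1 / real q + 1 - 1) * exp (- u)) has_integral Gamma (1 / real q + 1)) {0<..}"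
    by (intro has_integral_Gamma_greaterThan add_nonneg_pos) simp_all
  moreover have "u powr (1 / real q + 1 - 1) * exp (- u) = u powr (1 / real q - 1) * (u * exp (- u))"
    if "u \<in> {0<..}" for u
    using that by (simp add: powr_diff)
  ultimately have "((\<lambda>u. u powr (1 / real q - 1) * (u * exp (- u))) has_integral Gamma (1 / real q + 1)) {0<..}"
    using has_integral_cong by (metis (no_types, lifting))
  moreover have "Gamma (1 / real q + 1) = Gamma (1 / real q) / real q"
    using assms by (subst Gamma_plus1) (auto dest: nonpos_Ints_nonpos)
  ultimately show ?thesis
    using integral_power_substitution[OF assms, of "{0<..}" "\<lambda>u. u * exp (- u)"]
    unfolding T by (auto simp: has_integral_iff power2_eq_square)
qed

lemma integrable_on_Gamma_atLeast:
  fixes a x :: real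
  assumes "0 < a" "0 < x"
  shows "(\<lambda>u. u powr (a - 1) * exp (- u)) integrable_on {x..}"
proof -
  have "(\<lambda>u. u powr (a - 1) * exp (- u)) absolutely_integrable_on {0<..}"
    using has_integral_Gamma_greaterThan[OF assms(1)]
    by (intro nonnegative_absolutely_integrable_1) (auto simp: has_integral_iff)
  hence "(\<lambda>u. u powr (a - 1) * exp (- u)) absolutely_integrable_on {x..}"
    by (rule set_integrable_subset) (use assms(2) in auto)
  thus ?thesis by (rule set_lebesgue_integral_eq_integral(1))
qed

text \<open>The source of \<open>limit_shape\<close>: the substitution gives an incomplete Gamma
  integral, and \<open>limit_shape\<close> is its ratio to the complete one.\<close>

lemma integral_tail_exp_power:
  assumes "1 \<le> q" "0 < x"
  shows "integral {0<..} (\<lambda>y::real. indicator {x..} (y ^ q) * exp (- (y ^ q)))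
    = Gamma (1 / real q) / real q * limit_shape q x"
proof -
  let ?f = "\<lambda>u. u powr (1 / real q - 1) * exp (- u)"
  have T: "{y::real. 0 < y \<and> y ^ q \<in> {0<..}} = {0<..}" by auto
  have "(?f has_integral integral {x..} ?f) {x..}"
    using integrable_on_Gamma_atLeast[of "1 / real q" x] assms by (intro integrable_integral) auto
  moreover have "{0<..} \<inter> {x..} = {x..}" using assms(2) by auto
  ultimately have "((\<lambda>u. if u \<in> {x..} then ?f u else 0) has_integral integral {x..} ?f) {0<..}"
    by (simp add: has_integral_restrict_Int Int_commute del: atLeast_iff)
  moreover have "(\<lambda>u. if u \<in> {x..} then ?f u else 0)
      = (\<lambda>u. u powr (1 / real q - 1) * (indicator {x..} u * exp (- u)))" by (auto simp: indicator_def)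
  ultimately have *: "((\<lambda>u. u powr (1 / real q - 1) * (indicator {x..} u * exp (- u)))
      has_integral integral {x..} ?f) {0<..}" by (simp only:)
  have "integral {0<..} (\<lambda>y::real. indicator {x..} (y ^ q) * exp (- (y ^ q))) = integral {x..} ?f / real q"
    using integral_power_substitution[OF assms(1), of "{0<..}" "\<lambda>u. indicator {x..} u * exp (- u)"] *
    unfolding T by (auto simp: has_integral_iff)
  moreover have "0 < Gamma (1 / real q)" using assms(1) by (intro Gamma_real_pos) simp
  ultimately show ?thesis by (simp add: limit_shape_def)
qed

text \<open>The integrand has a positive minimum on \<open>{x..x + 1}\<close>. Positivity ensures
  that the limiting normal density has a positive standard deviation.\<close>

lemma limit_shape_pos:
  assumes "1 \<le> q" "0 < x"
  shows "0 < limit_shape q x"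
proof -
  let ?f = "\<lambda>u. u powr (1 / real q - 1) * exp (- u)"
  have int: "?f integrable_on {x..}" using assms by (intro integrable_on_Gamma_atLeast) auto
  have cont: "continuous_on {x..x + 1} ?f" using assms(2) by (auto intro!: continuous_intros)
  then obtain c where c: "c \<in> {x..x + 1}" "\<And>u. u \<in> {x..x + 1} \<Longrightarrow> ?f c \<le> ?f u"
    using continuous_attains_inf[of "{x..x + 1}" ?f] by auto
  have "0 < ?f c" using c(1) assms(2) by simp
  also have "?f c = integral {x..x + 1} (\<lambda>_. ?f c)" by simp
  also have "\<dots> \<le> integral {x..x + 1} ?f"
    using c(2) by (intro integral_le integrable_continuous_interval cont continuous_on_const)
  also have "\<dots> \<le> integral {x..} ?f"
    by (intro integral_subset_le integrable_continuous_interval cont int) auto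
  finally show ?thesis using Gamma_real_pos[of "1 / real q"] assms(1) by (simp add: limit_shape_def)
qed

text \<open>Reduction to the standard normal law by scaling the variable with
  \<open>\<sigma>\<close>.\<close>

lemma char_normal_distribution:
  assumes "0 < \<sigma>"
  shows "char (density lborel (normal_density 0 \<sigma>)) t = of_real (exp (- (\<sigma>\<^sup>2 * t\<^sup>2 / 2)))"
proof -
  interpret S: prob_space std_normal_distribution by (rule prob_space_normal_density) simp
  have "distributed std_normal_distribution lborel (\<lambda>y. y) std_normal_density"
    by (auto simp: distributed_def distr_id2)
  from S.normal_density_affine[OF this, of \<sigma> 0] assms
  have "distributed std_normal_distribution lborel (\<lambda>y. \<sigma> * y) (normal_density 0 \<sigma>)" by simp
  hence "density lborel (normal_density 0 \<sigma>) = distr std_normal_distribution lborel (\<lambda>y. \<sigma> * y)"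
    by (simp add: distributed_def)
  hence "char (density lborel (normal_density 0 \<sigma>)) t = (CLINT y|std_normal_distribution. iexp (t * (\<sigma> * y)))"
    by (simp add: char_def integral_distr)
  also have "\<dots> = char std_normal_distribution (t * \<sigma>)" by (simp add: char_def mult_ac)
  finally show ?thesis by (simp add: char_std_normal_distribution power_mult_distrib mult.commute)
qed

subsection \<open>Asymptotics of the calibrated parameters\<close>

text \<open>If \<open>z2 n\<close> were at least \<open>a\<close> for some large \<open>n\<close>,
  the weight bound with \<open>K\<close> of order \<open>M\<close> would give
  \<open>N \<le> D * M ^ (q + 1)\<close>, which contradicts \<open>\<kappa>\<close> falling below
  \<open>1 / D\<close>.\<close>

lemma calibrated_fugacity_tendsto:
  fixes N M z1 z2 :: "nat \<Rightarrow> real"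
  assumes q: "1 \<le> q" and cal: "\<And>n. calibrated q (N n) (M n) (z1 n) (z2 n)"
    and N: "\<And>n. 0 < N n" and M: "filterlim M at_top sequentially"
    and \<kappa>: "(\<lambda>n. M n ^ (q + 1) / N n) \<longlonglongrightarrow> 0"
  shows "z2 \<longlonglongrightarrow> 0"
proof (rule order_tendstoI)
  fix a :: real assume "a < 0"
  have "0 < z2 n" for n using cal[of n] by (simp add: calibrated_def)
  with \<open>a < 0\<close> show "\<forall>\<^sub>F n in sequentially. a < z2 n"
    by (intro always_eventually allI) (rule less_trans)
next
  fix a :: real assume "0 < a"
  define d where "d = min a 1"
  have d: "0 < d" "d \<le> 1" "d \<le> a" using \<open>0 < a\<close> by (auto simp: d_def)
  define C where "C = 1 + exp 1 / d"
  have C: "0 < C" using d by (simp add: C_def add_pos_pos)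
  \<comment> \<open>Rounding up gives \<open>K \<le> C * M + 1\<close>, and \<open>M \<ge> 1\<close>
    absorbs the 1 into \<open>(C + 1) * M\<close>; this accounts for \<open>C + 1\<close>.\<close>
  define D where "D = 4 * exp (3 / 2) * (C + 1) ^ (q + 1)"
  have D: "0 < D" using C by (simp add: D_def)
  have "\<forall>\<^sub>F n in sequentially. M n ^ (q + 1) / N n < 1 / D"
    using order_tendstoD(2)[OF \<kappa>] D by simp
  moreover have "\<forall>\<^sub>F n in sequentially. 1 \<le> M n" using M by (simp add: filterlim_at_top)
  ultimately show "\<forall>\<^sub>F n in sequentially. z2 n < a"
  proof eventually_elim
    fix n assume n: "M n ^ (q + 1) / N n < 1 / D" "1 \<le> M n"
    show "z2 n < a"
    proof (rule ccontr)
      assume "\<not> z2 n < a"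
      hence "d \<le> z2 n" using d by linarith
      define K where "K = nat \<lceil>C * M n\<rceil>"
      have CM: "0 < C * M n" using C n(2) by simp
      hence K: "C * M n \<le> real K" "real K \<le> C * M n + 1" "1 \<le> K"
        unfolding K_def by linarith+
      have "N n \<le> 4 * exp (3 / 2) * real K ^ (q + 1)"
        by (rule calibrated_weight_le[OF q cal d(1,2) \<open>d \<le> z2 n\<close> K(3)]) (use K(1) in \<open>simp add: C_def\<close>)
      also have "\<dots> \<le> 4 * exp (3 / 2) * ((C + 1) * M n) ^ (q + 1)"
        using K(2) n(2) by (intro mult_left_mono power_mono) (auto simp: algebra_simps)
      also have "\<dots> = D * M n ^ (q + 1)" by (simp only: D_def power_mult_distrib mult.assoc)
      finally have "1 / D \<le> M n ^ (q + 1) / N n" using D N[of n] by (simp add: field_simps)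
      with n(1) show False by linarith
    qed
  qed
qed

text \<open>Since \<open>Suc j ^ q \<ge> Suc j\<close>, the series for \<open>M\<close> is dominated
  by the geometric series with sum \<open>z2 * z1 / (1 - z1)\<close>; the inequality
  \<open>- ln z1 * z1 \<le> 1 - z1\<close> does the rest. It transfers the decay of
  \<open>z2\<close> to \<open>- ln z1\<close>.\<close>

lemma calibrated_rate_le:
  assumes q: "1 \<le> q" and cal: "calibrated q N M z1 z2"
  shows "(- ln z1) * M \<le> z2"
proof -
  have z: "0 < z1" "z1 < 1" "0 < z2" using cal by (simp_all add: calibrated_def)
  have geo: "summable (\<lambda>j. z2 * z1 * z1 ^ j)" using z by (intro summable_mult summable_geometric) simp
  have "M = (\<Sum>j. part_prob z1 z2 (Suc j ^ q))" using calibrated_sums(1)[OF q cal] by simp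
  also have "\<dots> \<le> (\<Sum>j. z2 * z1 * z1 ^ j)"
  proof (rule suminf_le[OF _ summable_part_prob[OF q z] geo])
    fix j
    have "Suc j \<le> Suc j ^ q" using q by (intro self_le_power) auto
    hence "z1 ^ (Suc j ^ q) \<le> z1 ^ Suc j" using z by (intro power_decreasing) auto
    hence "z1 ^ (Suc j ^ q) * z2 \<le> z2 * z1 * z1 ^ j" using z(3) by (simp add: mult_ac)
    with part_prob_le[OF z(1,3), of "Suc j ^ q"]
    show "part_prob z1 z2 (Suc j ^ q) \<le> z2 * z1 * z1 ^ j" by linarith
  qed
  also have "\<dots> = z2 * (z1 / (1 - z1))" using z by (simp add: suminf_mult suminf_geometric)
  finally have "(- ln z1) * M \<le> (- ln z1) * (z2 * (z1 / (1 - z1)))" using z by (intro mult_left_mono) auto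
  also have "\<dots> = z2 * (((- ln z1) * z1) / (1 - z1))" by simp
  also have "\<dots> \<le> z2 * 1"
  proof (intro mult_left_mono)
    have "- ln z1 \<le> 1 / z1 - 1" using ln_le_minus_one[of "1 / z1"] z by (simp add: ln_div)
    hence "(- ln z1) * z1 \<le> (1 / z1 - 1) * z1" using z by (intro mult_right_mono) auto
    hence "(- ln z1) * z1 \<le> 1 - z1" using z by (simp add: left_diff_distrib)
    thus "(- ln z1) * z1 / (1 - z1) \<le> 1" using z by (subst divide_le_eq_1_pos) auto
  qed (use z in simp)
  finally show ?thesis by simp
qed

lemma calibrated_rate_tendsto:
  fixes N M z1 z2 :: "nat \<Rightarrow> real"
  assumes q: "1 \<le> q" and cal: "\<And>n. calibrated q (N n) (M n) (z1 n) (z2 n)"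
    and M: "filterlim M at_top sequentially" and z2: "z2 \<longlonglongrightarrow> 0"
  shows "(\<lambda>n. - ln (z1 n)) \<longlonglongrightarrow> 0"
proof (rule tendsto_sandwich[OF _ _ tendsto_const z2])
  have pos: "0 < - ln (z1 n)" for n using cal[of n] by (simp add: calibrated_def)
  show "\<forall>\<^sub>F n in sequentially. 0 \<le> - ln (z1 n)" using less_imp_le[OF pos] by simp
  have "\<forall>\<^sub>F n in sequentially. 1 \<le> M n" using M by (simp add: filterlim_at_top)
  thus "\<forall>\<^sub>F n in sequentially. - ln (z1 n) \<le> z2 n"
  proof eventually_elim
    fix n assume "1 \<le> M n"
    hence "(- ln (z1 n)) * 1 \<le> (- ln (z1 n)) * M n" using pos[of n] by (intro mult_left_mono) auto
    with calibrated_rate_le[OF q cal[of n]] show "- ln (z1 n) \<le> z2 n" by linarith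
  qed
qed

text \<open>The sums for \<open>M\<close>, for \<open>- ln z1 * N\<close> and for the tail all
  converge after multiplication by the same factor \<open>?R\<close>. Only ratios matter, so
  \<open>?R\<close> cancels: weight over length locates the threshold, and tail over length gives
  the limit.\<close>

lemma boundary_mean_tendsto_limit_shape:
  fixes N M z1 z2 :: "nat \<Rightarrow> real"
  assumes q: "1 \<le> q" and cal: "\<And>n. calibrated q (N n) (M n) (z1 n) (z2 n)"
    and NM: "\<And>n. 0 < N n" "\<And>n. 0 < M n"
    and z2: "z2 \<longlonglongrightarrow> 0" and rate: "(\<lambda>n. - ln (z1 n)) \<longlonglongrightarrow> 0" and x: "0 < x"
  shows "(\<lambda>n. (\<Sum>j. indicator {l. real q * N n / M n * x \<le> real l} (Suc j ^ q) *
      part_prob (z1 n) (z2 n) (Suc j ^ q)) / M n) \<longlonglongrightarrow> limit_shape q x"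
proof -
  have z: "0 < z1 n" "z1 n < 1" "0 < z2 n" for n using cal[of n] by (simp_all add: calibrated_def)
  let ?\<alpha> = "\<lambda>n. - ln (z1 n)" and ?p = "\<lambda>n j. part_prob (z1 n) (z2 n) (Suc j ^ q)"
  let ?R = "\<lambda>n. (?\<alpha> n) powr (1 / real q) / z2 n" and ?G = "Gamma (1 / real q) / real q"
  define c where "c n = ?\<alpha> n * (real q * N n / M n * x)" for n
  have al: "0 < ?\<alpha> n" for n using z by simp
  have R: "0 < ?R n" for n using al[of n] z[of n] by simp
  have \<Gamma>: "0 < Gamma (1 / real q)" using q by (intro Gamma_real_pos) simp
  hence G: "0 < ?G" using q by simp
  note lim = weighted_sum_tendsto[OF q z rate z2]
  have "(\<lambda>n. ?R n * (\<Sum>j. 1 * ?p n j)) \<longlonglongrightarrow> integral {0<..} (\<lambda>y::real. 1 * exp (- (y ^ q)))"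
    using lim[where \<psi> = "\<lambda>_ _. 1" and \<psi>' = "\<lambda>_. 1" and x = 0] by simp
  hence L0: "(\<lambda>n. ?R n * M n) \<longlonglongrightarrow> ?G"
    by (simp only: mult_1 integral_exp_power[OF q] calibrated_sums(1)[OF q cal])
  have "(\<lambda>n. ?R n * (\<Sum>j. (?\<alpha> n * real (Suc j ^ q)) * ?p n j))
      \<longlonglongrightarrow> integral {0<..} (\<lambda>y::real. y ^ q * exp (- (y ^ q)))"
    by (rule lim[where \<psi> = "\<lambda>_ u. u" and \<psi>' = "\<lambda>u. u" and x = 0]) auto
  moreover have "(\<Sum>j. (?\<alpha> n * real (Suc j ^ q)) * ?p n j) = ?\<alpha> n * N n" for n
    unfolding mult.assoc
    by (simp only: suminf_mult[OF summable_mult_part_prob[OF q z]] calibrated_sums(2)[OF q cal])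
  ultimately have L1: "(\<lambda>n. ?R n * (?\<alpha> n * N n)) \<longlonglongrightarrow> ?G / real q"
    by (simp add: integral_power_mult_exp_power[OF q] power2_eq_square)
  \<comment> \<open>The quotient of the weight and length limits gives
    \<open>- ln z1 * N / M\<close> the limit \<open>1 / q\<close>, so the threshold
    \<open>A * x\<close>, rescaled by \<open>- ln z1\<close> to \<open>c n\<close>, tends to
    \<open>x\<close>.\<close>
  have "(\<lambda>n. real q * x * (?R n * (?\<alpha> n * N n) / (?R n * M n))) \<longlonglongrightarrow> real q * x * (?G / real q / ?G)"
    using q less_imp_neq[OF G] by (intro tendsto_mult tendsto_divide tendsto_const L0 L1) auto
  moreover have "real q * x * (?R n * (?\<alpha> n * N n) / (?R n * M n)) = c n" for n
    unfolding nonzero_mult_divide_mult_cancel_left[OF less_imp_neq[OF R, symmetric]] by (simp add: c_def)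
  moreover have "real q * x * (?G / real q / ?G) = x"
    using q less_imp_neq[OF \<Gamma>] by simp
  ultimately have c: "c \<longlonglongrightarrow> x" by (simp only: c_def[abs_def])
  have "(\<lambda>n. ?R n * (\<Sum>j. indicator {c n..} (?\<alpha> n * real (Suc j ^ q)) * ?p n j))
      \<longlonglongrightarrow> integral {0<..} (\<lambda>y::real. indicator {x..} (y ^ q) * exp (- (y ^ q)))"
  proof (rule lim[where \<psi> = "\<lambda>n. indicator {c n..}" and \<psi>' = "indicator {x..}" and x = x])
    fix v :: "nat \<Rightarrow> real" and u
    assume v: "v \<longlonglongrightarrow> u" and "u \<noteq> x"
    have "\<forall>\<^sub>F n in sequentially. indicator {c n..} (v n) = (indicator {x..} u :: real)"
    \<comment> \<open>Away from the jump at \<open>x\<close>, the sign of \<open>v n - c n\<close>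
      is eventually constant, so the indicators are eventually equal to their limit.\<close>
    proof (cases "x < u")
      case True
      have "\<forall>\<^sub>F n in sequentially. 0 < v n - c n"
        using True by (intro order_tendstoD(1)[OF tendsto_diff[OF v c]]) simp
      thus ?thesis by eventually_elim (use True in simp)
    next
      case False
      hence "u < x" using \<open>u \<noteq> x\<close> by simp
      have "\<forall>\<^sub>F n in sequentially. v n - c n < 0"
        using \<open>u < x\<close> by (intro order_tendstoD(2)[OF tendsto_diff[OF v c]]) simp
      thus ?thesis by eventually_elim (use \<open>u < x\<close> in simp)
    qed
    thus "(\<lambda>n. indicator {c n..} (v n)) \<longlonglongrightarrow> (indicator {x..} u :: real)" by (rule tendsto_eventually)
  qed (auto simp: indicator_def)
  \<comment> \<open>Cancelling the positive factor \<open>- ln z1\<close> turns the rescaled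
    threshold back into the one on the parts.\<close>
  moreover have "indicator {c n..} (?\<alpha> n * real l) = (indicator {l. real q * N n / M n * x \<le> real l} l :: real)" for n l
    unfolding c_def indicator_def using al[of n] by (simp only: atLeast_iff mem_Collect_eq mult_le_cancel_left_pos)
  ultimately have L2: "(\<lambda>n. ?R n * (\<Sum>j. indicator {l. real q * N n / M n * x \<le> real l} (Suc j ^ q) * ?p n j))
      \<longlonglongrightarrow> ?G * limit_shape q x"
    by (simp only: integral_tail_exp_power[OF q x])
  have "(\<lambda>n. (?R n * (\<Sum>j. indicator {l. real q * N n / M n * x \<le> real l} (Suc j ^ q) * ?p n j)) / (?R n * M n))
      \<longlonglongrightarrow> ?G * limit_shape q x / ?G"
    by (rule tendsto_divide[OF L2 L0 less_imp_neq[OF G, symmetric]])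
  moreover have "?G * limit_shape q x / ?G = limit_shape q x"
    by (rule nonzero_mult_div_cancel_left[OF less_imp_neq[OF G, symmetric]])
  ultimately show ?thesis
    by (simp only: nonzero_mult_divide_mult_cancel_left[OF less_imp_neq[OF R, symmetric]])
qed

section \<open>The boundary as a counting variable and its Gaussian limit\<close>

lemma young_boundary_eq_card:
  assumes "p \<in> strict_partitions q"
  shows "young_boundary p c = card (set p \<inter> {l. c \<le> real l})"
proof -
  have "young_boundary p c = (\<Sum>l\<in>{l \<in> set p. c \<le> real l}. 1)"
    unfolding young_boundary_def
    by (rule sum.cong) (auto simp: count_list_strict_partition[OF assms])
  also have "{l \<in> set p. c \<le> real l} = set p \<inter> {l. c \<le> real l}" by blast
  finally show ?thesis by simp
qed

lemma expectation_young_boundary: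
  assumes q: "1 \<le> q" and z: "0 < z1" "z1 < 1" "0 < z2"
  shows "summable (\<lambda>j. indicator {l. c \<le> real l} (Suc j ^ q) * part_prob z1 z2 (Suc j ^ q))" (is ?sm)
    and "measure_pmf.expectation (boltzmann q z1 z2) (\<lambda>p. real (young_boundary p c))
      = (\<Sum>j. indicator {l. c \<le> real l} (Suc j ^ q) * part_prob z1 z2 (Suc j ^ q))"
proof -
  show sm: ?sm
  proof (rule summable_part_prob_mult[OF q z])
    fix l
    have "0 \<le> (- ln z1) * real l" using z by (intro mult_nonneg_nonneg) auto
    thus "indicator {l. c \<le> real l} l \<le> 1 + (- ln z1) * real l" by (simp split: split_indicator)
  qed simp
  have eq: "real (young_boundary p c) = (\<Sum>l\<in>set p. indicator {l. c \<le> real l} l)"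
    if "p \<in> strict_partitions q" for p
    unfolding indicator_def by (simp add: young_boundary_eq_card[OF that])
  have "measure_pmf.expectation (boltzmann q z1 z2) (\<lambda>p. real (young_boundary p c))
     = measure_pmf.expectation (boltzmann q z1 z2) (\<lambda>p. \<Sum>l\<in>set p. indicator {l. c \<le> real l} l)"
    using set_pmf_boltzmann[OF z, of q]
    by (intro integral_cong_AE)
       (auto simp: AE_measure_pmf_iff subset_iff intro: eq)
  also have "\<dots> = (\<Sum>j. indicator {l. c \<le> real l} (Suc j ^ q) * part_prob z1 z2 (Suc j ^ q))"
    by (rule expectation_additive[OF q z _ sm]) simp
  finally show "measure_pmf.expectation (boltzmann q z1 z2) (\<lambda>p. real (young_boundary p c))
      = (\<Sum>j. indicator {l. c \<le> real l} (Suc j ^ q) * part_prob z1 z2 (Suc j ^ q))" .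
qed

text \<open>The left side is the characteristic function of a centred Poisson variable of mean
  \<open>m\<close>, at \<open>s = t / sqrt M\<close>. The quadratic Taylor term of the exponent is
  \<open>- (m / M) * t\<^sup>2 / 2\<close>, and the cubic remainder is at most
  \<open>m / M * t\<^sup>2 * \<bar>s\<bar>\<close>, which vanishes as \<open>s\<close> does.\<close>

lemma poisson_char_tendsto_gaussian:
  fixes m M :: "nat \<Rightarrow> real"
  assumes M: "\<And>n. 0 < M n" "filterlim M at_top sequentially" and m: "\<And>n. 0 \<le> m n"
    and lim: "(\<lambda>n. m n / M n) \<longlonglongrightarrow> w"
  shows "(\<lambda>n. exp (of_real (m n) * (iexp (t / sqrt (M n)) - 1 - \<i> * of_real (t / sqrt (M n)))))
      \<longlonglongrightarrow> of_real (exp (- (w * t\<^sup>2 / 2)))"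
proof -
  let ?s = "\<lambda>n. t / sqrt (M n)"
  let ?e = "\<lambda>n. of_real (m n) * (iexp (?s n) - 1 - \<i> * of_real (?s n))"
  have sq: "(?s n)\<^sup>2 = t\<^sup>2 / M n" for n using M(1)[of n] by (simp add: power_divide less_imp_le)
  have expand: "complex_of_real a * (iexp b - 1 - \<i> * of_real b) + of_real (a * b\<^sup>2 / 2)
      = of_real a * (iexp b - (\<Sum>k\<le>2. (\<i> * b) ^ k / fact k))" for a b
    by (simp add: numeral_2_eq_2 algebra_simps)
  have s0: "?s \<longlonglongrightarrow> 0"
    by (intro real_tendsto_divide_at_top[OF tendsto_const] filterlim_compose[OF sqrt_at_top M(2)])
  have "(\<lambda>n. ?e n + of_real (m n * (?s n)\<^sup>2 / 2)) \<longlonglongrightarrow> 0"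
  proof (rule Lim_null_comparison)
    have "norm (?e n + of_real (m n * (?s n)\<^sup>2 / 2)) \<le> m n / M n * (t\<^sup>2 * \<bar>?s n\<bar>)" for n
    proof -
      have "?e n + of_real (m n * (?s n)\<^sup>2 / 2)
          = of_real (m n) * (iexp (?s n) - (\<Sum>k\<le>2. (\<i> * ?s n) ^ k / fact k))"
        by (rule expand)
      also have "norm \<dots> \<le> m n * (\<bar>?s n\<bar> ^ Suc 2 / fact (Suc 2))"
        unfolding norm_mult norm_of_real abs_of_nonneg[OF m] by (rule mult_left_mono[OF iexp_approx1 m])
      also have "\<dots> \<le> m n * (\<bar>?s n\<bar> ^ Suc 2 / 1)"
        by (intro mult_left_mono divide_left_mono zero_le_power abs_ge_zero fact_ge_1 m) simp
      also have "\<dots> = m n * ((?s n)\<^sup>2 * \<bar>?s n\<bar>)" by (simp only: power_Suc2 power2_abs div_by_1)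
      also have "\<dots> = m n / M n * (t\<^sup>2 * \<bar>?s n\<bar>)" by (simp only: sq) simp
      finally show ?thesis .
    qed
    thus "\<forall>\<^sub>F n in sequentially. norm (?e n + of_real (m n * (?s n)\<^sup>2 / 2)) \<le> m n / M n * (t\<^sup>2 * \<bar>?s n\<bar>)"
      by simp
    have "(\<lambda>n. m n / M n * (t\<^sup>2 * \<bar>?s n\<bar>)) \<longlonglongrightarrow> w * (t\<^sup>2 * \<bar>0\<bar>)"
      by (intro tendsto_intros lim s0)
    thus "(\<lambda>n. m n / M n * (t\<^sup>2 * \<bar>?s n\<bar>)) \<longlonglongrightarrow> 0" by simp
  qed
  moreover have "(\<lambda>n. complex_of_real (m n * (?s n)\<^sup>2 / 2)) \<longlonglongrightarrow> of_real (w * t\<^sup>2 / 2)"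
  proof (rule tendsto_of_real)
    have "(\<lambda>n. m n / M n * t\<^sup>2 / 2) \<longlonglongrightarrow> w * t\<^sup>2 / 2" by (intro tendsto_intros lim) simp
    thus "(\<lambda>n. m n * (?s n)\<^sup>2 / 2) \<longlonglongrightarrow> w * t\<^sup>2 / 2" by (simp only: sq) simp
  qed
  ultimately have "(\<lambda>n. ?e n + of_real (m n * (?s n)\<^sup>2 / 2) - of_real (m n * (?s n)\<^sup>2 / 2))
      \<longlonglongrightarrow> 0 - of_real (w * t\<^sup>2 / 2)" by (rule tendsto_diff)
  hence "?e \<longlonglongrightarrow> of_real (- (w * t\<^sup>2 / 2))" by simp
  from tendsto_exp[OF this] show ?thesis by (simp only: exp_of_real)
qed

text \<open>Centring multiplies the characteristic function by a number of modulus 1, so the Poisson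
  approximation error is preserved. At \<open>s = t / sqrt M\<close> it is at most
  \<open>exp 2 * t\<^sup>2 * z2 * (m / M)\<close>, which tends to 0 because \<open>z2\<close> does
  and \<open>m / M\<close> converges.\<close>

lemma char_scaled_boundary_tendsto:
  fixes N M z1 z2 :: "nat \<Rightarrow> real"
  assumes q: "1 \<le> q" and NM: "\<And>n. 0 < N n" "\<And>n. 0 < M n"
    and cal: "\<And>n. calibrated q (N n) (M n) (z1 n) (z2 n)"
    and M: "filterlim M at_top sequentially"
    and \<kappa>: "(\<lambda>n. M n ^ (q + 1) / N n) \<longlonglongrightarrow> 0" and x: "0 < x"
  shows "(\<lambda>n. char (distr (measure_pmf (boltzmann q (z1 n) (z2 n))) borel
       (\<lambda>p. sqrt (M n) * (scaled_boundary q (N n) (M n) p x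
          - measure_pmf.expectation (boltzmann q (z1 n) (z2 n))
              (\<lambda>p. scaled_boundary q (N n) (M n) p x)))) t)
     \<longlonglongrightarrow> of_real (exp (- (limit_shape q x * t\<^sup>2 / 2)))"
proof -
  have z: "0 < z1 n" "z1 n < 1" "0 < z2 n" for n using cal[of n] by (simp_all add: calibrated_def)
  have z2: "z2 \<longlonglongrightarrow> 0" by (rule calibrated_fugacity_tendsto[OF q cal NM(1) M \<kappa>])
  have rate: "(\<lambda>n. - ln (z1 n)) \<longlonglongrightarrow> 0" by (rule calibrated_rate_tendsto[OF q cal M z2])
  define A where "A n = {l. real q * N n / M n * x \<le> real l}" for n
  define m where "m n = (\<Sum>j. indicator (A n) (Suc j ^ q) * part_prob (z1 n) (z2 n) (Suc j ^ q))" for n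
  define s where "s n = t / sqrt (M n)" for n
  let ?B = "\<lambda>n. boltzmann q (z1 n) (z2 n)"
  let ?X = "\<lambda>n p. sqrt (M n) * (scaled_boundary q (N n) (M n) p x
          - measure_pmf.expectation (?B n) (\<lambda>p. scaled_boundary q (N n) (M n) p x))"
  let ?\<phi> = "\<lambda>n. measure_pmf.expectation (?B n) (\<lambda>p. iexp (s n * real (card (set p \<inter> A n))))"
  have m_lim: "(\<lambda>n. m n / M n) \<longlonglongrightarrow> limit_shape q x"
    unfolding m_def A_def by (rule boundary_mean_tendsto_limit_shape[OF q cal NM z2 rate x])
  note sm = expectation_young_boundary[OF q z, where c = "real q * N n / M n * x" for n, folded A_def]
  have m_nonneg: "0 \<le> m n" for n
    unfolding m_def using part_prob_nonneg[OF z(1,3)] by (intro suminf_nonneg sm(1)) auto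
  have s_sq: "(s n)\<^sup>2 = t\<^sup>2 / M n" for n using NM(2)[of n] by (simp add: s_def power_divide less_imp_le)
  have char_eq: "char (distr (measure_pmf (?B n)) borel (?X n)) t
      = ?\<phi> n * exp (- (\<i> * of_real (s n * m n)))" for n
  proof -
    have mean: "measure_pmf.expectation (?B n) (\<lambda>p. scaled_boundary q (N n) (M n) p x) = m n / M n"
      using sm(2)[of n] by (simp add: scaled_boundary_def m_def)
    have "char (distr (measure_pmf (?B n)) borel (?X n)) t
        = measure_pmf.expectation (?B n) (\<lambda>p. iexp (t * ?X n p))"
      unfolding char_def by (subst integral_distr) auto
    also have "\<dots> = measure_pmf.expectation (?B n)
        (\<lambda>p. iexp (s n * real (card (set p \<inter> A n))) * exp (- (\<i> * of_real (s n * m n))))"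
    proof (intro integral_cong_AE)
      have "iexp (t * ?X n p) = iexp (s n * real (card (set p \<inter> A n))) * exp (- (\<i> * of_real (s n * m n)))"
        if "p \<in> set_pmf (?B n)" for p
      proof -
        have "p \<in> strict_partitions q" using that set_pmf_boltzmann[OF z] by blast
        hence "scaled_boundary q (N n) (M n) p x = real (card (set p \<inter> A n)) / M n"
          by (simp add: scaled_boundary_def young_boundary_eq_card A_def)
        hence "t * ?X n p = t * (sqrt (M n) / M n) * (real (card (set p \<inter> A n)) - m n)"
          unfolding mean by (simp add: diff_divide_distrib[symmetric])
        also have "t * (sqrt (M n) / M n) = s n"
          using NM(2)[of n] by (simp add: s_def real_sqrt_divide field_simps)
        finally have eq: "t * ?X n p = s n * (real (card (set p \<inter> A n)) - m n)" .
        show ?thesis unfolding eq by (simp add: exp_add[symmetric] algebra_simps)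
      qed
      thus "AE p in ?B n. iexp (t * ?X n p)
          = iexp (s n * real (card (set p \<inter> A n))) * exp (- (\<i> * of_real (s n * m n)))"
        by (simp add: AE_measure_pmf_iff)
    qed auto
    finally show ?thesis by simp
  qed
  have "(\<lambda>n. ?\<phi> n * exp (- (\<i> * of_real (s n * m n)))
      - exp (of_real (m n) * (iexp (s n) - 1 - \<i> * of_real (s n)))) \<longlonglongrightarrow> 0"
  proof (rule Lim_null_comparison)
    have "norm (?\<phi> n * exp (- (\<i> * of_real (s n * m n)))
        - exp (of_real (m n) * (iexp (s n) - 1 - \<i> * of_real (s n)))) \<le> exp 2 * t\<^sup>2 * z2 n * (m n / M n)" for n
    proof -
      have "exp (of_real (m n) * (iexp (s n) - 1 - \<i> * of_real (s n)))
          = exp (of_real (m n) * (iexp (s n) - 1)) * exp (- (\<i> * of_real (s n * m n)))"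
        by (simp add: exp_add[symmetric] algebra_simps)
      hence "norm (?\<phi> n * exp (- (\<i> * of_real (s n * m n)))
          - exp (of_real (m n) * (iexp (s n) - 1 - \<i> * of_real (s n))))
          = norm (?\<phi> n - exp (of_real (m n) * (iexp (s n) - 1)))"
        by (simp add: left_diff_distrib[symmetric] norm_mult)
      also have "\<dots> \<le> exp 2 * (s n)\<^sup>2 * z2 n * m n"
        unfolding m_def by (rule char_poisson_approx[OF q z sm(1)])
      finally show ?thesis unfolding s_sq by simp
    qed
    thus "\<forall>\<^sub>F n in sequentially. norm (?\<phi> n * exp (- (\<i> * of_real (s n * m n)))
        - exp (of_real (m n) * (iexp (s n) - 1 - \<i> * of_real (s n)))) \<le> exp 2 * t\<^sup>2 * z2 n * (m n / M n)"
      by simp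
    have "(\<lambda>n. exp 2 * t\<^sup>2 * z2 n * (m n / M n)) \<longlonglongrightarrow> exp 2 * t\<^sup>2 * 0 * limit_shape q x"
      by (intro tendsto_intros z2 m_lim)
    thus "(\<lambda>n. exp 2 * t\<^sup>2 * z2 n * (m n / M n)) \<longlonglongrightarrow> 0" by simp
  qed
  from tendsto_add[OF this poisson_char_tendsto_gaussian[OF NM(2) M m_nonneg m_lim, of t, folded s_def]]
  show ?thesis unfolding char_eq by simp
qed

theorem theorem5p6:
  fixes q :: nat and N M z1 z2 :: "nat \<Rightarrow> real" and x :: real
  assumes "1 \<le> q"
    and "\<And>n. 0 < N n" and "\<And>n. 0 < M n"
    and "\<forall>\<^sub>F n in sequentially. calibrated q (N n) (M n) (z1 n) (z2 n)"
    and "filterlim N at_top sequentially"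
    and "filterlim M at_top sequentially"
    and "(\<lambda>n. M n ^ (q + 1) / N n) \<longlonglongrightarrow> 0"
    and "0 < x"
  shows "weak_conv_m
    (\<lambda>n. distr (measure_pmf (boltzmann q (z1 n) (z2 n))) borel
       (\<lambda>p. sqrt (M n) * (scaled_boundary q (N n) (M n) p x
          - measure_pmf.expectation (boltzmann q (z1 n) (z2 n))
              (\<lambda>p. scaled_boundary q (N n) (M n) p x))))
    (density lborel (normal_density 0 (sqrt (limit_shape q x))))"
proof (rule levy_continuity)
  \<comment> \<open>Calibration holds only from some index on, whereas the limit of the
    characteristic functions was derived for sequences calibrated throughout. Shifting all sequences
    by \<open>k\<close> bridges this without changing limits.\<close>
  obtain k where k: "\<And>n. k \<le> n \<Longrightarrow> calibrated q (N n) (M n) (z1 n) (z2 n)"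
    using assms(4) by (auto simp: eventually_sequentially)
  have \<omega>: "0 < limit_shape q x" by (rule limit_shape_pos[OF assms(1,8)])
  show "real_distribution (distr (measure_pmf (boltzmann q (z1 n) (z2 n))) borel
       (\<lambda>p. sqrt (M n) * (scaled_boundary q (N n) (M n) p x
          - measure_pmf.expectation (boltzmann q (z1 n) (z2 n))
              (\<lambda>p. scaled_boundary q (N n) (M n) p x))))" for n
    by (rule prob_space.real_distribution_distr[OF prob_space_measure_pmf]) simp
  show "real_distribution (density lborel (normal_density 0 (sqrt (limit_shape q x))))"
    using prob_space_normal_density[of "sqrt (limit_shape q x)" 0] \<omega>
    by (simp add: real_distribution_def real_distribution_axioms_def)
  show "(\<lambda>n. char (distr (measure_pmf (boltzmann q (z1 n) (z2 n))) borel
       (\<lambda>p. sqrt (M n) * (scaled_boundary q (N n) (M n) p x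
          - measure_pmf.expectation (boltzmann q (z1 n) (z2 n))
              (\<lambda>p. scaled_boundary q (N n) (M n) p x)))) t)
     \<longlonglongrightarrow> char (density lborel (normal_density 0 (sqrt (limit_shape q x)))) t" for t
  proof (rule LIMSEQ_offset[where k = k])
    have "char (density lborel (normal_density 0 (sqrt (limit_shape q x)))) t
        = of_real (exp (- (limit_shape q x * t\<^sup>2 / 2)))"
      using char_normal_distribution[of "sqrt (limit_shape q x)" t] \<omega> by simp
    thus "(\<lambda>n. char (distr (measure_pmf (boltzmann q (z1 (n + k)) (z2 (n + k)))) borel
       (\<lambda>p. sqrt (M (n + k)) * (scaled_boundary q (N (n + k)) (M (n + k)) p x
          - measure_pmf.expectation (boltzmann q (z1 (n + k)) (z2 (n + k)))
              (\<lambda>p. scaled_boundary q (N (n + k)) (M (n + k)) p x)))) t)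
     \<longlonglongrightarrow> char (density lborel (normal_density 0 (sqrt (limit_shape q x)))) t"
      using char_scaled_boundary_tendsto[OF assms(1), of "\<lambda>n. N (n + k)" "\<lambda>n. M (n + k)"
          "\<lambda>n. z1 (n + k)" "\<lambda>n. z2 (n + k)" x t] assms(2,3,8) k
        LIMSEQ_ignore_initial_segment[OF assms(7), of k]
        filterlim_compose[OF assms(6) filterlim_add_const_nat_at_top, of k]
      by simp
  qed
qed

end
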